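(* Let $\Phi_+$ be a vector space of finite dimension $d$ over a field, with fixed basis $\mathcal{B}=\{x_1,\ldots,x_d\}$, and let $\vee$, $[\;\cdot\;]$ and $\widetilde{\mu}$ be the regressive product, the bracket, and the bilinear function on $\bigwedge\Phi_+\times\bigwedge\Phi_+$ determined by $\mathcal{B}$ as defined in the context. For any $\eta,\zeta\in\bigwedge\Phi_+$, $\widetilde{\mu}(\eta,\zeta)=\eta\vee\zeta$. Hence for blades $\alpha=u_1\wedge\cdots\wedge u_l$ and $\beta=v_1\wedge\cdots\wedge v_m$ in $\bigwedge\Phi_+$, of respective degrees $l$ and $m$ such that $l+m\geqslant d$, we have $$\alpha\vee\beta=\sum_{\substack{I\subset\{1,\ldots,l\}\\ |I|=n}}(-1)^{\overline{I}I}\,[\,u_{\overline{I}}\wedge\beta\,]\cdot u_I=\sum_{\substack{I\subset\{1,\ldots,m\}\\ |I|=n}}(-1)^{I\overline{I}}\,[\,\alpha\wedge v_{\overline{I}}\,]\cdot v_I$$ where $n=l+m-d$.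
   Context: Regressive product: let $H:\bigwedge\Phi_+\to\bigwedge\Phi_+^{\top}$ be the vector space isomorphism such that for every $n$ and every permutation $\rho=\begin{pmatrix}1&\cdots&d\\ i_1&\cdots&i_d\end{pmatrix}$, $H(x_{i_1}\wedge\cdots\wedge x_{i_n})=(-1)^{\rho}\cdot x_{i_{n+1}}^{\top}\wedge\cdots\wedge x_{i_d}^{\top}$, where $\{x_1^{\top},\ldots,x_d^{\top}\}$ is the dual basis and $(-1)^\rho$ is the sign of $\rho$ (empty products equal $1$). Then $\chi\vee\psi=H^{-1}(H(\chi)\wedge H(\psi))$. Bracket: for $\xi$ an exterior product of $d$ vectors (or any $\xi\in\bigwedge^d\Phi_+$), $[\xi]$ is the scalar with $\xi=[\xi]\cdot x_1\wedge\cdots\wedge x_d$. Blades: an $l$-blade is a nonzero exterior product of $l$ vectors; nonzero scalars are $0$-blades. Multi-index notation: for $I=\{i_1,\ldots,i_n\}\subset\{1,\ldots,l\}$ with $|I|=n$, $\overline{I}=\{i_{n+1},\ldots,i_l\}$ is its complement in $\{1,\ldots,l\}$ (both with fixed chosen orderings of their elements); $u_I=u_{i_1}\wedge\cdots\wedge u_{i_n}$, $u_{\overline{I}}=u_{i_{n+1}}\wedge\cdots\wedge u_{i_l}$; $(-1)^{I\overline{I}}$ is the sign of the permutation $(i_1,\ldots,i_n,i_{n+1},\ldots,i_l)$ of $(1,\ldots,l)$, and $(-1)^{\overline{I}I}$ is the sign of the permutation $(i_{n+1},\ldots,i_l,i_1,\ldots,i_n)$ of $(1,\ldots,l)$. In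 sums over $I\subset\{1,\ldots,m\}$ complements are taken in $\{1,\ldots,m\}$ and the same conventions apply with $m$ and the $v$'s in place of $l$ and the $u$'s. The functions $\mu$ and $\widetilde{\mu}$: for blades $\alpha=u_1\wedge\cdots\wedge u_l$ and $\beta=v_1\wedge\cdots\wedge v_m$ with $l+m\geqslant d$ and $n=l+m-d$, $\mu(\alpha,\beta)$ denotes the common value of the two equal expressions $$\sum_{\substack{I\subset\{1,\ldots,l\}\\ |I|=n}}(-1)^{\overline{I}I}[u_{\overline{I}}\wedge\beta]\cdot u_I=\sum_{\substack{I\subset\{1,\ldots,m\}\\ |I|=n}}(-1)^{I\overline{I}}[\alpha\wedge v_{\overline{I}}]\cdot v_I.$$ With $x_J$ ($J\subset\{1,\ldots,d\}$) denoting the basis of $\bigwedge\Phi_+$ made of exterior products of elements of $\mathcal{B}$, $\widetilde{\mu}:\bigwedge\Phi_+\times\bigwedge\Phi_+\to\bigwedge\Phi_+$ is the bilinear function with $\widetilde{\mu}(x_J,x_K)=\mu(x_J,x_K)$ if $|J|+|K|\geqslant d$, and $\widetilde{\mu}(x_J,x_K)=0$ otherwise. *)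

theory Defs
  imports
    Complex_Main
    "HOL-Algebra.QuotRing"
    "HOL-Combinatorics.Permutations"
    "HOL-Library.Poly_Mapping"
    "HOL-Library.Function_Algebras"
begin

section \<open>The exterior algebra\<close>

text \<open>
  Words over \<^typ>\<open>'v\<close> under concatenation, written additively, because the product on
  \<^typ>\<open>'a \<Rightarrow>\<^sub>0 'b\<close> is convolution over a \<^class>\<open>monoid_add\<close>. Thus
  \<open>'v word \<Rightarrow>\<^sub>0 'k\<close> is the free associative unital algebra on the letters \<open>'v\<close>.
\<close>

datatype 'v word = Word (letters: "'v list")

instantiation word :: (type) monoid_add
begin
definition zero_word :: "'v word" where "zero_word = Word []"
definition plus_word :: "'v word \<Rightarrow> 'v word \<Rightarrow> 'v word"
  where "plus_word a b = Word (letters a @ letters b)"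
instance by standard (simp_all add: zero_word_def plus_word_def)
end

definition letter :: "'v \<Rightarrow> ('v word \<Rightarrow>\<^sub>0 'k::field)"
  where "letter v = Poly_Mapping.single (Word [v]) 1"

definition const_poly :: "'k \<Rightarrow> ('v word \<Rightarrow>\<^sub>0 'k::field)"
  where "const_poly c = Poly_Mapping.single 0 c"

definition free_algebra :: "'v set \<Rightarrow> ('v word \<Rightarrow>\<^sub>0 'k::field) ring"
  where "free_algebra S =
    \<lparr>carrier = {p. \<forall>w\<in>Poly_Mapping.keys p. set (letters w) \<subseteq> S},
     monoid.mult = (*), one = 1, zero = 0, add = (+)\<rparr>"

text \<open>
  \<open>S\<close> is (the carrier of) a vector space with scalar multiplication \<open>scale\<close>. Modulo the first two
  families of relations the free algebra on \<open>S\<close> is the tensor algebra of \<open>S\<close>; the third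
  family is \<open>v \<otimes> v = 0\<close>.
\<close>

definition exterior_relations ::
  "('k::field \<Rightarrow> 'v::ab_group_add \<Rightarrow> 'v) \<Rightarrow> 'v set \<Rightarrow> ('v word \<Rightarrow>\<^sub>0 'k) set"
  where "exterior_relations scale S =
    {letter (a + b) - letter a - letter b | a b. a \<in> S \<and> b \<in> S} \<union>
    {letter (scale c a) - const_poly c * letter a | c a. a \<in> S} \<union>
    {letter a * letter a | a. a \<in> S}"

definition exterior_ideal ::
  "('k::field \<Rightarrow> 'v::ab_group_add \<Rightarrow> 'v) \<Rightarrow> 'v set \<Rightarrow> ('v word \<Rightarrow>\<^sub>0 'k) set"
  where "exterior_ideal scale S = genideal (free_algebra S) (exterior_relations scale S)"

definition exterior_algebra ::
  "('k::field \<Rightarrow> 'v::ab_group_add \<Rightarrow> 'v) \<Rightarrow> 'v set \<Rightarrow> ('v word \<Rightarrow>\<^sub>0 'k) set ring"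
  where "exterior_algebra scale S = free_algebra S Quot exterior_ideal scale S"

text \<open>
  \<^const>\<open>genideal\<close> is an intersection of two-sided ideals, which is the intended one only if the
  ambient structure is a ring and contains the relations.
\<close>

lemma ring_free_algebra: "ring (free_algebra S :: ('v word \<Rightarrow>\<^sub>0 'k::field) ring)"
proof (rule ringI)
  show "abelian_group (free_algebra S :: ('v word \<Rightarrow>\<^sub>0 'k) ring)"
  proof (rule abelian_groupI)
    fix p assume p: "p \<in> carrier (free_algebra S :: ('v word \<Rightarrow>\<^sub>0 'k) ring)"
    then have "- p \<in> carrier (free_algebra S :: ('v word \<Rightarrow>\<^sub>0 'k) ring)"
      by (simp add: free_algebra_def)
    then show "\<exists>q\<in>carrier (free_algebra S :: ('v word \<Rightarrow>\<^sub>0 'k) ring).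
        q \<oplus>\<^bsub>free_algebra S\<^esub> p = \<zero>\<^bsub>free_algebra S\<^esub>"
      by (intro bexI[of _ "- p"]) (simp_all add: free_algebra_def)
  next
    fix p q :: "'v word \<Rightarrow>\<^sub>0 'k"
    assume "p \<in> carrier (free_algebra S)" "q \<in> carrier (free_algebra S)"
    then show "p \<oplus>\<^bsub>free_algebra S\<^esub> q \<in> carrier (free_algebra S)"
      using Poly_Mapping.keys_add[of p q] by (fastforce simp: free_algebra_def)
  qed (auto simp: free_algebra_def algebra_simps)
  show "monoid (free_algebra S :: ('v word \<Rightarrow>\<^sub>0 'k) ring)"
  proof (rule monoidI)
    fix p q :: "'v word \<Rightarrow>\<^sub>0 'k"
    assume "p \<in> carrier (free_algebra S)" "q \<in> carrier (free_algebra S)"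
    then show "p \<otimes>\<^bsub>free_algebra S\<^esub> q \<in> carrier (free_algebra S)"
      using Poly_Mapping.keys_mult[of p q] by (fastforce simp: free_algebra_def plus_word_def)
  qed (auto simp: free_algebra_def algebra_simps zero_word_def)
qed (auto simp: free_algebra_def algebra_simps)

lemma exterior_relations_carrier:
  assumes "\<And>a b. a \<in> S \<Longrightarrow> b \<in> S \<Longrightarrow> a + b \<in> S" and "\<And>c a. a \<in> S \<Longrightarrow> scale c a \<in> S"
  shows "exterior_relations scale S \<subseteq> carrier (free_algebra S)"
proof -
  have letter: "letter a \<in> carrier (free_algebra S :: ('v word \<Rightarrow>\<^sub>0 'k::field) ring)"
    if "a \<in> S" for a and S :: "'v set"
    using that by (auto simp: free_algebra_def letter_def)
  have const_poly: "const_poly c \<in> carrier (free_algebra S :: ('v word \<Rightarrow>\<^sub>0 'k::field) ring)"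
    for c and S :: "'v set"
    by (auto simp: free_algebra_def const_poly_def zero_word_def)
  have diff: "p - q \<in> carrier (free_algebra S)"
    if "p \<in> carrier (free_algebra S)" "q \<in> carrier (free_algebra S)"
    for p q :: "'v word \<Rightarrow>\<^sub>0 'k::field" and S :: "'v set"
    using that Poly_Mapping.keys_diff[of p q] by (fastforce simp: free_algebra_def)
  have mult: "p * q \<in> carrier (free_algebra S)"
    if "p \<in> carrier (free_algebra S)" "q \<in> carrier (free_algebra S)"
    for p q :: "'v word \<Rightarrow>\<^sub>0 'k::field" and S :: "'v set"
    using that Poly_Mapping.keys_mult[of p q] by (fastforce simp: free_algebra_def plus_word_def)
  show ?thesis
    using assms unfolding exterior_relations_def
    by (auto intro!: letter const_poly diff mult)
qed

definition exterior_smult ::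
  "('k::field \<Rightarrow> 'v::ab_group_add \<Rightarrow> 'v) \<Rightarrow> 'v set \<Rightarrow> 'k
    \<Rightarrow> ('v word \<Rightarrow>\<^sub>0 'k) set \<Rightarrow> ('v word \<Rightarrow>\<^sub>0 'k) set"
  where "exterior_smult scale S c \<xi> =
    (exterior_ideal scale S +>\<^bsub>free_algebra S\<^esub> const_poly c) \<otimes>\<^bsub>exterior_algebra scale S\<^esub> \<xi>"

definition exterior_vector ::
  "('k::field \<Rightarrow> 'v::ab_group_add \<Rightarrow> 'v) \<Rightarrow> 'v set \<Rightarrow> 'v \<Rightarrow> ('v word \<Rightarrow>\<^sub>0 'k) set"
  where "exterior_vector scale S v = exterior_ideal scale S +>\<^bsub>free_algebra S\<^esub> letter v"

text \<open>\<open>wedge_list scale S [v\<^sub>1, \<dots>, v\<^sub>n]\<close> is \<open>v\<^sub>1 \<and> \<dots> \<and> v\<^sub>n\<close>.\<close>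

definition wedge_list ::
  "('k::field \<Rightarrow> 'v::ab_group_add \<Rightarrow> 'v) \<Rightarrow> 'v set \<Rightarrow> 'v list \<Rightarrow> ('v word \<Rightarrow>\<^sub>0 'k) set"
  where "wedge_list scale S vs =
    foldr (\<lambda>v \<xi>. exterior_vector scale S v \<otimes>\<^bsub>exterior_algebra scale S\<^esub> \<xi>) vs
      \<one>\<^bsub>exterior_algebra scale S\<^esub>"


section \<open>The space with its basis, and the dual space\<close>

text \<open>\<open>\<Phi>\<^sub>+\<close> is the whole type \<open>'v\<close>, with basis \<open>x 1, \<dots>, x d\<close>.\<close>

definition ordered_basis ::
  "('k::field \<Rightarrow> 'v::ab_group_add \<Rightarrow> 'v) \<Rightarrow> (nat \<Rightarrow> 'v) \<Rightarrow> nat \<Rightarrow> bool"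
  where "ordered_basis scale x d \<longleftrightarrow>
    inj_on x {1..d} \<and> \<not> module.dependent scale (x ` {1..d}) \<and>
    module.span scale (x ` {1..d}) = UNIV"

definition dual_space ::
  "('k::field \<Rightarrow> 'v::ab_group_add \<Rightarrow> 'v) \<Rightarrow> ('v \<Rightarrow> 'k) set"
  where "dual_space scale = {f. Vector_Spaces.linear scale (*) f}"

definition dual_scale :: "'k::field \<Rightarrow> ('v \<Rightarrow> 'k) \<Rightarrow> ('v \<Rightarrow> 'k)"
  where "dual_scale c f = (\<lambda>v. c * f v)"

definition dual_basis ::
  "('k::field \<Rightarrow> 'v::ab_group_add \<Rightarrow> 'v) \<Rightarrow> (nat \<Rightarrow> 'v) \<Rightarrow> nat \<Rightarrow> nat \<Rightarrow> ('v \<Rightarrow> 'k)"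
  where "dual_basis scale x d i =
    (THE f. f \<in> dual_space scale \<and> (\<forall>j\<in>{1..d}. f (x j) = (if i = j then 1 else 0)))"

abbreviation Ext :: "('k::field \<Rightarrow> 'v::ab_group_add \<Rightarrow> 'v) \<Rightarrow> ('v word \<Rightarrow>\<^sub>0 'k) set ring"
  where "Ext scale \<equiv> exterior_algebra scale UNIV"

abbreviation ext_smult ::
  "('k::field \<Rightarrow> 'v::ab_group_add \<Rightarrow> 'v) \<Rightarrow> 'k \<Rightarrow> ('v word \<Rightarrow>\<^sub>0 'k) set \<Rightarrow> ('v word \<Rightarrow>\<^sub>0 'k) set"
  where "ext_smult scale \<equiv> exterior_smult scale UNIV"

abbreviation ext_wedge ::
  "('k::field \<Rightarrow> 'v::ab_group_add \<Rightarrow> 'v) \<Rightarrow> 'v list \<Rightarrow> ('v word \<Rightarrow>\<^sub>0 'k) set"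
  where "ext_wedge scale \<equiv> wedge_list scale UNIV"

abbreviation Ext_dual ::
  "('k::field \<Rightarrow> 'v::ab_group_add \<Rightarrow> 'v) \<Rightarrow> (('v \<Rightarrow> 'k) word \<Rightarrow>\<^sub>0 'k) set ring"
  where "Ext_dual scale \<equiv> exterior_algebra dual_scale (dual_space scale)"

abbreviation dual_smult ::
  "('k::field \<Rightarrow> 'v::ab_group_add \<Rightarrow> 'v) \<Rightarrow> 'k
    \<Rightarrow> (('v \<Rightarrow> 'k) word \<Rightarrow>\<^sub>0 'k) set \<Rightarrow> (('v \<Rightarrow> 'k) word \<Rightarrow>\<^sub>0 'k) set"
  where "dual_smult scale \<equiv> exterior_smult dual_scale (dual_space scale)"

abbreviation dual_wedge ::
  "('k::field \<Rightarrow> 'v::ab_group_add \<Rightarrow> 'v) \<Rightarrow> ('v \<Rightarrow> 'k) list \<Rightarrow> (('v \<Rightarrow> 'k) word \<Rightarrow>\<^sub>0 'k) set"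
  where "dual_wedge scale \<equiv> wedge_list dual_scale (dual_space scale)"


section \<open>Regressive product and bracket\<close>

definition is_H ::
  "('k::field \<Rightarrow> 'v::ab_group_add \<Rightarrow> 'v) \<Rightarrow> (nat \<Rightarrow> 'v) \<Rightarrow> nat
    \<Rightarrow> (('v word \<Rightarrow>\<^sub>0 'k) set \<Rightarrow> (('v \<Rightarrow> 'k) word \<Rightarrow>\<^sub>0 'k) set) \<Rightarrow> bool"
  where "is_H scale x d H \<longleftrightarrow>
    bij_betw H (carrier (Ext scale)) (carrier (Ext_dual scale)) \<and>
    (\<forall>\<xi>\<in>carrier (Ext scale). \<forall>\<eta>\<in>carrier (Ext scale).
       H (\<xi> \<oplus>\<^bsub>Ext scale\<^esub> \<eta>) = H \<xi> \<oplus>\<^bsub>Ext_dual scale\<^esub> H \<eta>) \<and>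
    (\<forall>c. \<forall>\<xi>\<in>carrier (Ext scale). H (ext_smult scale c \<xi>) = dual_smult scale c (H \<xi>)) \<and>
    (\<forall>n\<le>d. \<forall>\<rho>. \<rho> permutes {1..d} \<longrightarrow>
       H (ext_wedge scale (map (\<lambda>k. x (\<rho> k)) [1..<Suc n])) =
         dual_smult scale (of_int (sign \<rho>))
           (dual_wedge scale (map (\<lambda>k. dual_basis scale x d (\<rho> k)) [Suc n..<Suc d])))"

text \<open>The choice is immaterial: \<^const>\<open>is_H\<close> determines \<open>H\<close> on the carrier.\<close>

definition H_map ::
  "('k::field \<Rightarrow> 'v::ab_group_add \<Rightarrow> 'v) \<Rightarrow> (nat \<Rightarrow> 'v) \<Rightarrow> nat
    \<Rightarrow> ('v word \<Rightarrow>\<^sub>0 'k) set \<Rightarrow> (('v \<Rightarrow> 'k) word \<Rightarrow>\<^sub>0 'k) set"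
  where "H_map scale x d = (SOME H. is_H scale x d H)"

definition regressive ::
  "('k::field \<Rightarrow> 'v::ab_group_add \<Rightarrow> 'v) \<Rightarrow> (nat \<Rightarrow> 'v) \<Rightarrow> nat
    \<Rightarrow> ('v word \<Rightarrow>\<^sub>0 'k) set \<Rightarrow> ('v word \<Rightarrow>\<^sub>0 'k) set \<Rightarrow> ('v word \<Rightarrow>\<^sub>0 'k) set"
  where "regressive scale x d \<chi> \<psi> =
    inv_into (carrier (Ext scale)) (H_map scale x d)
      (H_map scale x d \<chi> \<otimes>\<^bsub>Ext_dual scale\<^esub> H_map scale x d \<psi>)"

definition bracket ::
  "('k::field \<Rightarrow> 'v::ab_group_add \<Rightarrow> 'v) \<Rightarrow> (nat \<Rightarrow> 'v) \<Rightarrow> nat \<Rightarrow> ('v word \<Rightarrow>\<^sub>0 'k) set \<Rightarrow> 'k"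
  where "bracket scale x d \<xi> =
    (THE c. \<xi> = ext_smult scale c (ext_wedge scale (map x [1..<Suc d])))"


section \<open>The functions \<open>\<mu>\<close> and \<open>\<mu>\<close>-tilde\<close>

text \<open>\<open>ord I\<close> is the chosen ordering of the elements of the finite index set \<open>I\<close>.\<close>

definition index_ordering :: "(nat set \<Rightarrow> nat list) \<Rightarrow> bool"
  where "index_ordering ord \<longleftrightarrow> (\<forall>I. finite I \<longrightarrow> distinct (ord I) \<and> set (ord I) = I)"

text \<open>Sign of the permutation \<open>k \<mapsto> i\<^sub>k\<close> of \<open>{1..l}\<close> given by a list \<open>[i\<^sub>1, \<dots>, i\<^sub>l]\<close>.\<close>

definition list_sign :: "nat list \<Rightarrow> int"
  where "list_sign is = sign (\<lambda>k. if k \<in> {1..length is} then is ! (k - 1) else k)"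

definition mu_left ::
  "('k::field \<Rightarrow> 'v::ab_group_add \<Rightarrow> 'v) \<Rightarrow> (nat \<Rightarrow> 'v) \<Rightarrow> nat \<Rightarrow> (nat set \<Rightarrow> nat list)
    \<Rightarrow> nat \<Rightarrow> nat \<Rightarrow> (nat \<Rightarrow> 'v) \<Rightarrow> ('v word \<Rightarrow>\<^sub>0 'k) set \<Rightarrow> ('v word \<Rightarrow>\<^sub>0 'k) set"
  where "mu_left scale x d ord l n u \<beta> =
    (\<Oplus>\<^bsub>Ext scale\<^esub> I \<in> {I. I \<subseteq> {1..l} \<and> card I = n}.
       ext_smult scale
         (of_int (list_sign (ord ({1..l} - I) @ ord I)) *
          bracket scale x d (ext_wedge scale (map u (ord ({1..l} - I))) \<otimes>\<^bsub>Ext scale\<^esub> \<beta>))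
         (ext_wedge scale (map u (ord I))))"

definition mu_right ::
  "('k::field \<Rightarrow> 'v::ab_group_add \<Rightarrow> 'v) \<Rightarrow> (nat \<Rightarrow> 'v) \<Rightarrow> nat \<Rightarrow> (nat set \<Rightarrow> nat list)
    \<Rightarrow> nat \<Rightarrow> nat \<Rightarrow> ('v word \<Rightarrow>\<^sub>0 'k) set \<Rightarrow> (nat \<Rightarrow> 'v) \<Rightarrow> ('v word \<Rightarrow>\<^sub>0 'k) set"
  where "mu_right scale x d ord m n \<alpha> v =
    (\<Oplus>\<^bsub>Ext scale\<^esub> I \<in> {I. I \<subseteq> {1..m} \<and> card I = n}.
       ext_smult scale
         (of_int (list_sign (ord I @ ord ({1..m} - I))) *
          bracket scale x d (\<alpha> \<otimes>\<^bsub>Ext scale\<^esub> ext_wedge scale (map v (ord ({1..m} - I)))))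
         (ext_wedge scale (map v (ord I))))"

text \<open>
  The common value of the two sums, for every way of writing the blades \<open>\<alpha>\<close> and \<open>\<beta>\<close> as
  products of vectors.
\<close>

definition mu ::
  "('k::field \<Rightarrow> 'v::ab_group_add \<Rightarrow> 'v) \<Rightarrow> (nat \<Rightarrow> 'v) \<Rightarrow> nat \<Rightarrow> (nat set \<Rightarrow> nat list)
    \<Rightarrow> ('v word \<Rightarrow>\<^sub>0 'k) set \<Rightarrow> ('v word \<Rightarrow>\<^sub>0 'k) set \<Rightarrow> ('v word \<Rightarrow>\<^sub>0 'k) set"
  where "mu scale x d ord \<alpha> \<beta> =
    (THE \<gamma>. \<forall>l m u v.
       \<alpha> = ext_wedge scale (map u [1..<Suc l]) \<and> \<beta> = ext_wedge scale (map v [1..<Suc m]) \<and>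
       d \<le> l + m \<longrightarrow>
         \<gamma> = mu_left scale x d ord l (l + m - d) u \<beta> \<and>
         \<gamma> = mu_right scale x d ord m (l + m - d) \<alpha> v)"

definition ext_bilinear ::
  "('k::field \<Rightarrow> 'v::ab_group_add \<Rightarrow> 'v)
    \<Rightarrow> (('v word \<Rightarrow>\<^sub>0 'k) set \<Rightarrow> ('v word \<Rightarrow>\<^sub>0 'k) set \<Rightarrow> ('v word \<Rightarrow>\<^sub>0 'k) set) \<Rightarrow> bool"
  where "ext_bilinear scale f \<longleftrightarrow>
    (\<forall>\<xi>\<in>carrier (Ext scale). \<forall>\<eta>\<in>carrier (Ext scale). f \<xi> \<eta> \<in> carrier (Ext scale) \<and>
      (\<forall>c. f (ext_smult scale c \<xi>) \<eta> = ext_smult scale c (f \<xi> \<eta>) \<and>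
           f \<xi> (ext_smult scale c \<eta>) = ext_smult scale c (f \<xi> \<eta>)) \<and>
      (\<forall>\<zeta>\<in>carrier (Ext scale).
           f (\<xi> \<oplus>\<^bsub>Ext scale\<^esub> \<zeta>) \<eta> = f \<xi> \<eta> \<oplus>\<^bsub>Ext scale\<^esub> f \<zeta> \<eta> \<and>
           f \<xi> (\<eta> \<oplus>\<^bsub>Ext scale\<^esub> \<zeta>) = f \<xi> \<eta> \<oplus>\<^bsub>Ext scale\<^esub> f \<xi> \<zeta>))"

definition is_mu_tilde ::
  "('k::field \<Rightarrow> 'v::ab_group_add \<Rightarrow> 'v) \<Rightarrow> (nat \<Rightarrow> 'v) \<Rightarrow> nat \<Rightarrow> (nat set \<Rightarrow> nat list)
    \<Rightarrow> (('v word \<Rightarrow>\<^sub>0 'k) set \<Rightarrow> ('v word \<Rightarrow>\<^sub>0 'k) set \<Rightarrow> ('v word \<Rightarrow>\<^sub>0 'k) set) \<Rightarrow> bool"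
  where "is_mu_tilde scale x d ord f \<longleftrightarrow> ext_bilinear scale f \<and>
    (\<forall>J K. J \<subseteq> {1..d} \<and> K \<subseteq> {1..d} \<longrightarrow>
       f (ext_wedge scale (map x (ord J))) (ext_wedge scale (map x (ord K))) =
         (if card J + card K \<ge> d
          then mu scale x d ord (ext_wedge scale (map x (ord J))) (ext_wedge scale (map x (ord K)))
          else \<zero>\<^bsub>Ext scale\<^esub>))"

text \<open>The choice is immaterial: \<^const>\<open>is_mu_tilde\<close> determines the function on the carrier.\<close>

definition mu_tilde ::
  "('k::field \<Rightarrow> 'v::ab_group_add \<Rightarrow> 'v) \<Rightarrow> (nat \<Rightarrow> 'v) \<Rightarrow> nat \<Rightarrow> (nat set \<Rightarrow> nat list)
    \<Rightarrow> ('v word \<Rightarrow>\<^sub>0 'k) set \<Rightarrow> ('v word \<Rightarrow>\<^sub>0 'k) set \<Rightarrow> ('v word \<Rightarrow>\<^sub>0 'k) set"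
  where "mu_tilde scale x d ord = (SOME f. is_mu_tilde scale x d ord f)"

end

theory Submission
  imports Defs
begin

text \<open>
  Write \<open>D = {1..d}\<close> and \<open>e(I)\<close> for the product of the basis vectors \<open>x i\<close>, \<open>i \<in> I\<close>, in increasing
  order. The \<open>e(I)\<close> form a basis of the exterior algebra, so an element is a function on the subsets
  of \<open>D\<close>, and \<open>e(I) \<and> e(J) = \<sigma>(I, J) e(I \<union> J)\<close> for disjoint \<open>I, J\<close>, where \<open>\<sigma>(I, J)\<close> is the sign of
  the shuffle that sorts \<open>I\<close> followed by \<open>J\<close>. In these coordinates \<open>H\<close> replaces \<open>I\<close> by \<open>D - I\<close> up
  to sign, and multiplicativity of \<open>\<sigma>\<close> in both arguments collapses all signs to
  \<open>e(P) \<or> e(Q) = \<sigma>(D - Q, D - P) e(P \<inter> Q)\<close> if \<open>P \<union> Q = D\<close>, and \<open>0\<close> otherwise (\<open>vee_basis\<close>).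

  The formula for \<open>\<alpha> \<or> \<beta>\<close> comes from a Leibniz rule: multiplication by a vector \<open>v\<close> is an
  antiderivation of \<open>\<or>\<close>. With the grade involution \<open>\<epsilon>\<close> it reads
  \<open>(\<alpha> \<and> v) \<or> \<beta> = (\<alpha> \<or> \<beta>) \<and> v + \<epsilon>(\<alpha> \<or> (v \<and> \<beta>))\<close> (\<open>vee_wedge_vec\<close>).
  Peeling off the factors of \<open>\<alpha> = u 1 \<and> \<dots> \<and> u l\<close> one at a time, each is either kept or passed to
  \<open>\<beta>\<close>. Let \<open>I\<close> be the set of indices kept and \<open>K\<close> its complement. The kept factors form \<open>u(I)\<close>, the
  passed ones are multiplied onto \<open>\<beta>\<close>, and what is left at the end, \<open>1 \<or> (u(K) \<and> \<beta>)\<close>, is the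
  bracket of \<open>u(K) \<and> \<beta>\<close>. The accumulated sign is \<open>\<sigma>(K, I)\<close>. This is \<open>vee_expansion\<close>, the first
  sum of the theorem. The second one follows since \<open>\<and>\<close> and \<open>\<or>\<close> both commute up to a sign that
  depends only on degrees (\<open>vee_expansion_right\<close>).

  Both sums therefore equal \<open>\<alpha> \<or> \<beta>\<close> however the blades are factored, which makes \<open>\<mu>\<close> well
  defined and equal to \<open>\<or>\<close> on the basis. For \<open>|P| + |Q| < d\<close> the union \<open>P \<union> Q\<close> is not \<open>D\<close>, so
  \<open>\<or>\<close> vanishes where \<open>\<mu>\<close>-tilde does, and bilinearity gives the equality everywhere.

  What has to be supplied is that the exterior algebra, a quotient of a free algebra, really has the
  basis \<open>e(I)\<close>. Evaluating words in the coordinate model kills the relations, which gives independence;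
  sorting words modulo the relations gives spanning (\<open>normal_form_congr\<close>, \<open>coord_bij\<close>). The same
  argument serves the space and its dual.
\<close>

text \<open>
  Equations \<open>(f + g) x = \<dots>\<close> also rewrite the unapplied \<open>f + g\<close> into an abstraction, which would
  destroy the algebraic form of sums of multivectors. Keeping \<open>1\<close> and \<open>[1..<Suc n]\<close> as they are lets
  the bounds of index ranges match syntactically.
\<close>

declare plus_fun_apply [simp del] zero_fun_apply [simp del] One_nat_def [simp del] upt_Suc [simp del]

lemma sum_fun_apply: "(\<Sum>i\<in>A. F i) K = (\<Sum>i\<in>A. F i K)"
  by (induction A rule: infinite_finite_induct) (auto simp: plus_fun_apply zero_fun_apply)

section \<open>Signs of shuffles\<close>

definition shuffle_sign :: "nat set \<Rightarrow> nat set \<Rightarrow> 'k::comm_ring_1"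
  where "shuffle_sign I J = (-1) ^ card {(i, j). i \<in> I \<and> j \<in> J \<and> j < i}"

lemma finite_inversions:
  "finite I \<Longrightarrow> finite J \<Longrightarrow> finite {(i, j). i \<in> I \<and> j \<in> J \<and> j < (i::nat)}"
  by (rule finite_subset[of _ "I \<times> J"]) auto

lemma shuffle_sign_empty [simp]: "shuffle_sign {} J = 1" "shuffle_sign I {} = 1"
  by (simp_all add: shuffle_sign_def)

lemma shuffle_sign_Un_left:
  assumes "finite I" "finite I'" "finite J" "I \<inter> I' = {}"
  shows "shuffle_sign (I \<union> I') J = shuffle_sign I J * shuffle_sign I' J"
proof -
  have "{(i, j). i \<in> I \<union> I' \<and> j \<in> J \<and> j < i} =
    {(i, j). i \<in> I \<and> j \<in> J \<and> j < i} \<union> {(i, j). i \<in> I' \<and> j \<in> J \<and> j < i}" by auto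
  then show ?thesis
    using assms unfolding shuffle_sign_def power_add[symmetric]
    by (subst card_Un_disjoint[symmetric]) (auto intro: finite_inversions)
qed

lemma shuffle_sign_Un_right:
  assumes "finite I" "finite J" "finite J'" "J \<inter> J' = {}"
  shows "shuffle_sign I (J \<union> J') = shuffle_sign I J * shuffle_sign I J'"
proof -
  have "{(i, j). i \<in> I \<and> j \<in> J \<union> J' \<and> j < i} =
    {(i, j). i \<in> I \<and> j \<in> J \<and> j < i} \<union> {(i, j). i \<in> I \<and> j \<in> J' \<and> j < i}" by auto
  then show ?thesis
    using assms unfolding shuffle_sign_def power_add[symmetric]
    by (subst card_Un_disjoint[symmetric]) (auto intro: finite_inversions)
qed

lemma shuffle_sign_square [simp]: "shuffle_sign I J * shuffle_sign I J = 1"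
  by (simp add: shuffle_sign_def flip: power_add mult_2)

lemma shuffle_sign_cancel [simp]: "shuffle_sign I J * (shuffle_sign I J * a) = a"
  by (simp flip: mult.assoc)

lemma shuffle_sign_swap:
  assumes "finite I" "finite J" "I \<inter> J = {}"
  shows "shuffle_sign J I = (-1) ^ (card I * card J) * shuffle_sign I J"
proof -
  have "{(i, j). i \<in> J \<and> j \<in> I \<and> j < i} = prod.swap ` {(i, j). i \<in> I \<and> j \<in> J \<and> i < j}"
    by auto
  then have c: "card {(i, j). i \<in> J \<and> j \<in> I \<and> j < i} = card {(i, j). i \<in> I \<and> j \<in> J \<and> i < j}"
    by (simp add: card_image)
  have "I \<times> J = {(i, j). i \<in> I \<and> j \<in> J \<and> i < j} \<union> {(i, j). i \<in> I \<and> j \<in> J \<and> j < i}"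
    using assms(3) by (auto simp: neq_iff)
  then have "card I * card J = card \<dots>"
    by (metis card_cartesian_product)
  also have "\<dots> = card {(i, j). i \<in> I \<and> j \<in> J \<and> i < j} + card {(i, j). i \<in> I \<and> j \<in> J \<and> j < i}"
    using assms by (intro card_Un_disjoint) (auto intro: finite_subset[of _ "I \<times> J"])
  finally have "shuffle_sign J I * shuffle_sign I J = ((-1) ^ (card I * card J) :: 'a)"
    by (simp add: shuffle_sign_def power_add c)
  then show ?thesis
    by (metis mult.assoc mult.right_neutral shuffle_sign_square)
qed

lemma shuffle_sign_sorted:
  assumes "\<And>i j. i \<in> I \<Longrightarrow> j \<in> J \<Longrightarrow> i \<le> j"
  shows "shuffle_sign I J = 1"
proof -
  have "{(i, j). i \<in> I \<and> j \<in> J \<and> j < i} = {}"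
    using assms by (auto simp: not_less)
  then show ?thesis
    unfolding shuffle_sign_def by (simp only: card.empty power_0)
qed

lemma shuffle_sign_singleton: "shuffle_sign {i} J = (-1) ^ card {j \<in> J. j < i}"
proof -
  have "{(i', j). i' \<in> {i} \<and> j \<in> J \<and> j < i'} = Pair i ` {j \<in> J. j < i}" by auto
  then show ?thesis
    by (simp add: shuffle_sign_def card_image inj_on_def)
qed

section \<open>A coordinate model of the exterior algebra\<close>

definition scalar_mult :: "'k::comm_ring_1 \<Rightarrow> (nat set \<Rightarrow> 'k) \<Rightarrow> (nat set \<Rightarrow> 'k)" (infixr "\<cdot>" 75)
  where "c \<cdot> f = (\<lambda>K. c * f K)"

definition wedge :: "(nat set \<Rightarrow> 'k::comm_ring_1) \<Rightarrow> (nat set \<Rightarrow> 'k) \<Rightarrow> (nat set \<Rightarrow> 'k)"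
    (infixr "\<curlywedge>" 70)
  where "f \<curlywedge> g = (\<lambda>K. \<Sum>I\<in>Pow K. shuffle_sign I (K - I) * f I * g (K - I))"

definition basis_blade :: "nat set \<Rightarrow> nat set \<Rightarrow> 'k::comm_ring_1"
  where "basis_blade I = (\<lambda>K. if K = I then 1 else 0)"

text \<open>
  The product of two functions is a sum over all subsets, which is \<open>0\<close> at an infinite set by the
  convention for infinite sums; the unit laws hold only for functions carried by finite sets.
\<close>

definition multivectors :: "nat \<Rightarrow> (nat set \<Rightarrow> 'k::comm_ring_1) set"
  where "multivectors d = {f. \<forall>K. f K \<noteq> 0 \<longrightarrow> K \<subseteq> {1..d}}"

lemmas pointwise = fun_eq_iff plus_fun_apply zero_fun_apply scalar_mult_def

lemma scalar_mult_simps [simp]: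
  "c \<cdot> 0 = 0" "0 \<cdot> f = 0" "1 \<cdot> f = f" "a \<cdot> b \<cdot> f = (a * b) \<cdot> f"
  by (auto simp: pointwise)

lemma scalar_mult_apply: "(c \<cdot> f) K = c * f K"
  by (simp add: scalar_mult_def)

lemma scalar_mult_add: "c \<cdot> (f + g) = c \<cdot> f + c \<cdot> g" "(a + b) \<cdot> f = a \<cdot> f + b \<cdot> f"
  by (auto simp: pointwise algebra_simps)

lemma scalar_mult_sum: "c \<cdot> (\<Sum>i\<in>A. F i) = (\<Sum>i\<in>A. c \<cdot> F i)"
  by (induction A rule: infinite_finite_induct) (simp_all add: scalar_mult_add)

lemma wedge_add:
  "(f + g) \<curlywedge> h = f \<curlywedge> h + g \<curlywedge> h" "h \<curlywedge> (f + g) = h \<curlywedge> f + h \<curlywedge> g"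
  by (auto simp: wedge_def pointwise algebra_simps sum.distrib)

lemma wedge_scalar: "(c \<cdot> f) \<curlywedge> g = c \<cdot> (f \<curlywedge> g)" "f \<curlywedge> (c \<cdot> g) = c \<cdot> (f \<curlywedge> g)"
  by (auto simp: wedge_def pointwise sum_distrib_left mult_ac)

lemma wedge_zero [simp]: "0 \<curlywedge> g = 0" "f \<curlywedge> 0 = 0"
  by (auto simp: wedge_def pointwise)

lemma wedge_sum:
  "(\<Sum>i\<in>A. F i) \<curlywedge> g = (\<Sum>i\<in>A. F i \<curlywedge> g)" "g \<curlywedge> (\<Sum>i\<in>A. F i) = (\<Sum>i\<in>A. g \<curlywedge> F i)"
  by (induction A rule: infinite_finite_induct) (auto simp: wedge_add)

text \<open>
  Both sides sum over the ways to split \<open>K\<close> into three parts \<open>I, A, B\<close>; the signs agree because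
  each is \<open>\<sigma>(I, A) \<sigma>(I, B) \<sigma>(A, B)\<close>.
\<close>

lemma wedge_assoc: "(f \<curlywedge> g) \<curlywedge> h = f \<curlywedge> (g \<curlywedge> h)"
proof
  fix K :: "nat set"
  show "((f \<curlywedge> g) \<curlywedge> h) K = (f \<curlywedge> (g \<curlywedge> h)) K"
  proof (cases "finite K")
    case False
    then show ?thesis by (simp add: wedge_def)
  next
    case True
    have fin: "finite M" if "M \<subseteq> K" for M
      using that True finite_subset by blast
    have "((f \<curlywedge> g) \<curlywedge> h) K = (\<Sum>(M, I)\<in>Sigma (Pow K) Pow.
        shuffle_sign M (K - M) * shuffle_sign I (M - I) * (f I * g (M - I) * h (K - M)))"
      using True by (subst sum.Sigma[symmetric])
        (auto simp: wedge_def sum_distrib_left sum_distrib_right mult_ac fin intro!: sum.cong)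
    also have "\<dots> = (\<Sum>(I, J)\<in>Sigma (Pow K) (\<lambda>I. Pow (K - I)).
        shuffle_sign I (K - I) * shuffle_sign J (K - I - J) * (f I * g J * h (K - I - J)))"
    proof (rule sum.reindex_bij_witness[where i = "\<lambda>(I, J). (I \<union> J, I)" and j = "\<lambda>(M, I). (I, M - I)"],
        goal_cases)
      case (5 p)
      obtain M I where p: "p = (M, I)" by (cases p)
      with 5 have M: "M \<subseteq> K" and I: "I \<subseteq> M" by auto
      have "K - I = (M - I) \<union> (K - M)" "K - I - (M - I) = K - M" "M = I \<union> (M - I)"
        using M I by auto
      then have
        "shuffle_sign I (K - I) = (shuffle_sign I (M - I) * shuffle_sign I (K - M) :: 'a)"
        "shuffle_sign M (K - M) = (shuffle_sign I (K - M) * shuffle_sign (M - I) (K - M) :: 'a)"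
        using shuffle_sign_Un_right[of I "M - I" "K - M"] shuffle_sign_Un_left[of I "M - I" "K - M"]
          M I fin[of I] fin[of M] fin[of "K - M"] by (auto)
      with \<open>K - I - (M - I) = K - M\<close> show ?case
        by (simp add: p mult_ac)
    qed auto
    also have "\<dots> = (f \<curlywedge> (g \<curlywedge> h)) K"
      using True by (subst sum.Sigma[symmetric])
        (auto simp: wedge_def sum_distrib_left mult_ac fin intro!: sum.cong)
    finally show ?thesis .
  qed
qed

lemma wedge_basis_blade:
  assumes "finite I" "finite J"
  shows "basis_blade I \<curlywedge> basis_blade J = (if I \<inter> J = {} then shuffle_sign I J \<cdot> basis_blade (I \<union> J) else (0 :: nat set \<Rightarrow> 'k::comm_ring_1))"
proof
  fix K
  have "(basis_blade I \<curlywedge> basis_blade J) K = (\<Sum>A\<in>Pow K. if A = I then shuffle_sign A (K - A) * basis_blade J (K - A) else 0 :: 'k)"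
    unfolding wedge_def by (rule sum.cong) (auto simp: basis_blade_def)
  also have "\<dots> = (if I \<subseteq> K \<and> K - I = J then shuffle_sign I J else 0)"
  proof (cases "finite K")
    case True
    then show ?thesis by (subst sum.delta) (auto simp: basis_blade_def)
  next
    case False
    then have "\<not> (I \<subseteq> K \<and> K - I = J)" using assms by auto
    with False show ?thesis by auto
  qed
  also have "\<dots> = (if I \<inter> J = {} then shuffle_sign I J \<cdot> basis_blade (I \<union> J) else 0) K"
    by (auto simp: basis_blade_def pointwise)
  finally show "(basis_blade I \<curlywedge> basis_blade J) K = (if I \<inter> J = {} then shuffle_sign I J \<cdot> basis_blade (I \<union> J) else (0 :: nat set \<Rightarrow> 'k)) K" .
qed

lemma multivectors_zero [simp]: "0 \<in> multivectors d"
  by (simp add: multivectors_def pointwise)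

lemma multivectors_add [simp]:
  assumes "f \<in> multivectors d" "g \<in> multivectors d"
  shows "f + g \<in> multivectors d"
  unfolding multivectors_def
proof (intro CollectI allI impI)
  fix K assume "(f + g) K \<noteq> 0"
  then have "f K \<noteq> 0 \<or> g K \<noteq> 0" by (auto simp: pointwise)
  then show "K \<subseteq> {1..d}" using assms by (auto simp: multivectors_def)
qed

lemma multivectors_scalar [simp]: "f \<in> multivectors d \<Longrightarrow> c \<cdot> f \<in> multivectors d"
  by (force simp: multivectors_def pointwise)

lemma multivectors_mon [simp]: "I \<subseteq> {1..d} \<Longrightarrow> basis_blade I \<in> multivectors d"
  by (simp add: multivectors_def basis_blade_def)

lemma multivectors_sum [simp]:
  "(\<And>i. i \<in> A \<Longrightarrow> F i \<in> multivectors d) \<Longrightarrow> (\<Sum>i\<in>A. F i) \<in> multivectors d"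
  by (induction A rule: infinite_finite_induct) auto

lemma multivectors_expand:
  assumes "f \<in> multivectors d"
  shows "f = (\<Sum>I\<in>Pow {1..d}. f I \<cdot> basis_blade I)"
proof
  fix K
  have "(\<Sum>I\<in>Pow {1..d}. f I \<cdot> basis_blade I) K = (\<Sum>I\<in>Pow {1..d}. if I = K then f I else 0)"
    unfolding sum_fun_apply by (rule sum.cong) (auto simp: basis_blade_def scalar_mult_apply)
  also have "\<dots> = f K"
    using assms by (subst sum.delta) (auto simp: multivectors_def)
  finally show "f K = (\<Sum>I\<in>Pow {1..d}. f I \<cdot> basis_blade I) K" by simp
qed

lemma multivectors_induct [consumes 1, case_names add scalar blade]:
  assumes f: "f \<in> multivectors d"
    and add: "\<And>f g. f \<in> multivectors d \<Longrightarrow> g \<in> multivectors d \<Longrightarrow> P f \<Longrightarrow> P g \<Longrightarrow> P (f + g)"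
    and scalar: "\<And>c f. f \<in> multivectors d \<Longrightarrow> P f \<Longrightarrow> P (c \<cdot> f)"
    and blade: "\<And>I. I \<subseteq> {1..d} \<Longrightarrow> P (basis_blade I)"
  shows "P f"
proof -
  have "P (\<Sum>I\<in>A. f I \<cdot> basis_blade I)" if "finite A" "A \<subseteq> Pow {1..d}" for A
    using that
  proof (induction A rule: finite_induct)
    case empty
    have "P (0 \<cdot> basis_blade {})" by (intro scalar blade) auto
    then show ?case by simp
  next
    case (insert I A)
    then show ?case by (auto intro!: add scalar blade multivectors_sum)
  qed
  from this[of "Pow {1..d}"] show ?thesis
    using multivectors_expand[OF f] by simp
qed

lemma multivectors_wedge [simp]:
  assumes "f \<in> multivectors d" "g \<in> multivectors d"
  shows "f \<curlywedge> g \<in> multivectors d"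
proof -
  have fin: "finite I" if "I \<subseteq> {1..d}" for I using that finite_subset by blast
  have "basis_blade I \<curlywedge> g \<in> multivectors d" if "I \<subseteq> {1..d}" for I
    using assms(2) that by (induction rule: multivectors_induct) (auto simp: wedge_add wedge_scalar wedge_basis_blade fin)
  with assms(1) show ?thesis
    by (induction rule: multivectors_induct) (auto simp: wedge_add wedge_scalar)
qed

lemma wedge_unit [simp]:
  assumes "f \<in> multivectors d"
  shows "basis_blade {} \<curlywedge> f = f" "f \<curlywedge> basis_blade {} = f"
proof -
  have fin: "finite I" if "I \<subseteq> {1..d}" for I using that finite_subset by blast
  show "basis_blade {} \<curlywedge> f = f" "f \<curlywedge> basis_blade {} = f"
    using assms by (induction rule: multivectors_induct) (auto simp: wedge_add wedge_scalar wedge_basis_blade fin)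
qed

text \<open>
  The vector with coordinates \<open>a\<close>, as a multivector of degree one.
\<close>

definition vec :: "nat \<Rightarrow> (nat \<Rightarrow> 'k::comm_ring_1) \<Rightarrow> nat set \<Rightarrow> 'k"
  where "vec d a = (\<Sum>i\<in>{1..d}. a i \<cdot> basis_blade {i})"

lemma vec_multivectors [simp]: "vec d a \<in> multivectors d"
  unfolding vec_def by (intro multivectors_sum multivectors_scalar multivectors_mon) auto

lemma vec_add: "vec d (\<lambda>i. a i + b i) = vec d a + vec d b"
  by (simp add: vec_def scalar_mult_add sum.distrib)

lemma vec_scalar: "vec d (\<lambda>i. c * a i) = c \<cdot> vec d a"
  by (simp add: vec_def scalar_mult_sum)

lemma vec_unit:
  assumes "i \<in> {1..d}" "\<And>j. j \<in> {1..d} \<Longrightarrow> a j = (if j = i then 1 else 0)"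
  shows "vec d a = basis_blade {i}"
proof -
  have "vec d a = (\<Sum>j\<in>{1..d}. if j = i then basis_blade {j} else 0)"
    unfolding vec_def using assms(2) by (intro sum.cong) auto
  then show ?thesis using assms(1) by simp
qed

text \<open>
  The vanishing diagonal is a separate hypothesis so that the lemma covers characteristic two.
\<close>

lemma sum_antisymmetric:
  fixes b :: "'i \<Rightarrow> 'i \<Rightarrow> 'b::ab_group_add"
  assumes "\<And>i. b i i = 0" "\<And>i j. b i j = - b j i"
  shows "(\<Sum>i\<in>A. \<Sum>j\<in>A. b i j) = 0"
proof (induction A rule: infinite_finite_induct)
  case (insert k A)
  have "(\<Sum>i\<in>A. b i k) = - (\<Sum>i\<in>A. b k i)"
    by (subst sum_negf[symmetric], rule sum.cong) (rule refl, rule assms(2))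
  with insert show ?case by (simp add: assms(1) sum.distrib)
qed auto

lemma basis_blade_anticommute: "basis_blade {i} \<curlywedge> basis_blade {j} = - (basis_blade {j} \<curlywedge> basis_blade {i} :: nat set \<Rightarrow> 'k::comm_ring_1)"
proof (cases "i = j")
  case True
  then show ?thesis by (simp add: wedge_basis_blade)
next
  case False
  then show ?thesis
    using shuffle_sign_swap[of "{j}" "{i}", where 'a = 'k]
    by (simp add: wedge_basis_blade insert_commute pointwise)
qed

lemma vec_alternating: "vec d a \<curlywedge> vec d a = (0 :: nat set \<Rightarrow> 'k::comm_ring_1)"
proof -
  have "vec d a \<curlywedge> vec d a = (\<Sum>i\<in>{1..d}. \<Sum>j\<in>{1..d}. (a i * a j) \<cdot> (basis_blade {i} \<curlywedge> basis_blade {j}))"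
    unfolding vec_def wedge_sum(1) wedge_sum(2) by (subst sum.swap) (simp add: wedge_scalar mult.commute)
  also have "\<dots> = 0"
  proof (rule sum_antisymmetric)
    fix i j
    show "(a i * a i) \<cdot> (basis_blade {i} \<curlywedge> basis_blade {i} :: nat set \<Rightarrow> 'k) = 0"
      by (simp add: wedge_basis_blade)
    show "(a i * a j) \<cdot> (basis_blade {i} \<curlywedge> basis_blade {j} :: nat set \<Rightarrow> 'k) = - ((a j * a i) \<cdot> (basis_blade {j} \<curlywedge> basis_blade {i}))"
      by (subst basis_blade_anticommute) (auto simp: scalar_mult_apply pointwise)
  qed
  finally show ?thesis .
qed

definition wedges :: "(nat set \<Rightarrow> 'k::comm_ring_1) list \<Rightarrow> nat set \<Rightarrow> 'k"
  where "wedges fs = foldr (\<curlywedge>) fs (basis_blade {})"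

lemma wedges_simps [simp]: "wedges [] = basis_blade {}" "wedges (f # fs) = f \<curlywedge> wedges fs"
  by (simp_all add: wedges_def)

lemma wedges_multivectors [simp]: "set fs \<subseteq> multivectors d \<Longrightarrow> wedges fs \<in> multivectors d"
  by (induction fs) auto

lemma wedges_append:
  "set fs \<subseteq> multivectors d \<Longrightarrow> set gs \<subseteq> multivectors d \<Longrightarrow> wedges (fs @ gs) = wedges fs \<curlywedge> wedges gs"
  by (induction fs) (auto simp: wedge_assoc wedge_unit[OF wedges_multivectors])

section \<open>Degree\<close>

definition homogeneous :: "nat \<Rightarrow> nat \<Rightarrow> (nat set \<Rightarrow> 'k::comm_ring_1) \<Rightarrow> bool"
  where "homogeneous d l f \<longleftrightarrow> (\<forall>K. f K \<noteq> 0 \<longrightarrow> K \<subseteq> {1..d} \<and> card K = l)"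

lemma homogeneous_vec: "homogeneous d 1 (vec d a)"
  unfolding homogeneous_def vec_def sum_fun_apply
proof (intro allI impI)
  fix K assume "(\<Sum>i\<in>{1..d}. (a i \<cdot> basis_blade {i}) K) \<noteq> 0"
  then obtain i where "i \<in> {1..d}" "(a i \<cdot> basis_blade {i}) K \<noteq> 0"
    by (rule sum.not_neutral_contains_not_neutral)
  then show "K \<subseteq> {1..d} \<and> card K = 1" by (auto simp: basis_blade_def scalar_mult_apply split: if_splits)
qed

lemma homogeneous_wedge:
  assumes "homogeneous d l f" "homogeneous d m g"
  shows "homogeneous d (l + m) (f \<curlywedge> g)"
  unfolding homogeneous_def
proof (intro allI impI)
  fix K assume "(f \<curlywedge> g) K \<noteq> 0"
  then obtain I where "I \<in> Pow K" "shuffle_sign I (K - I) * f I * g (K - I) \<noteq> 0"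
    unfolding wedge_def by (rule sum.not_neutral_contains_not_neutral)
  then have "I \<subseteq> K" "f I \<noteq> 0" "g (K - I) \<noteq> 0" by auto
  with assms have I: "I \<subseteq> {1..d}" "card I = l" and KI: "K - I \<subseteq> {1..d}" "card (K - I) = m"
    by (auto simp: homogeneous_def)
  have "card (I \<union> (K - I)) = l + m"
    using I KI by (subst card_Un_disjoint) (auto intro: finite_subset)
  with I KI \<open>I \<subseteq> K\<close> show "K \<subseteq> {1..d} \<and> card K = l + m"
    by (auto simp: Un_absorb1)
qed

lemma homogeneous_wedges:
  "(\<And>f. f \<in> set fs \<Longrightarrow> homogeneous d 1 f) \<Longrightarrow> homogeneous d (length fs) (wedges fs)"
proof (induction fs)
  case Nil
  then show ?case by (auto simp: homogeneous_def basis_blade_def)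
next
  case (Cons f fs)
  then show ?case using homogeneous_wedge[of d 1 f "length fs" "wedges fs"] by (auto simp del: Suc_eq_plus1_left simp: Suc_eq_plus1_left[symmetric])
qed

lemma homogeneous_multivectors: "homogeneous d l f \<Longrightarrow> f \<in> multivectors d"
  by (auto simp: homogeneous_def multivectors_def)

text \<open>
  Reindexing by complements turns \<open>\<sigma>(I, K - I)\<close> into \<open>\<sigma>(K - I, I)\<close>, and the two differ by
  \<open>(-1)\<close> to the number of pairs.
\<close>

lemma wedge_graded_commute:
  assumes "homogeneous d l f" "homogeneous d m g"
  shows "g \<curlywedge> f = (-1) ^ (l * m) \<cdot> (f \<curlywedge> g)"
proof
  fix K
  show "(g \<curlywedge> f) K = ((-1) ^ (l * m) \<cdot> (f \<curlywedge> g)) K"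
  proof (cases "finite K")
    case False
    then show ?thesis by (simp add: wedge_def pointwise)
  next
    case True
    have "(g \<curlywedge> f) K = (\<Sum>I\<in>Pow K. shuffle_sign (K - I) I * g (K - I) * f I)"
      unfolding wedge_def
      by (rule sum.reindex_bij_witness[where i = "\<lambda>I. K - I" and j = "\<lambda>I. K - I"])
        (auto simp: double_diff)
    also have "\<dots> = (\<Sum>I\<in>Pow K. (-1) ^ (l * m) * (shuffle_sign I (K - I) * f I * g (K - I)))"
    proof (rule sum.cong)
      fix I assume "I \<in> Pow K"
      then have "finite I" "finite (K - I)" using True by (auto intro: finite_subset)
      then show "shuffle_sign (K - I) I * g (K - I) * f I
          = (-1) ^ (l * m) * (shuffle_sign I (K - I) * f I * g (K - I))"
        using assms shuffle_sign_swap[of I "K - I", where 'a = 'a]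
        by (cases "f I = 0 \<or> g (K - I) = 0") (auto simp: homogeneous_def mult_ac)
    qed simp
    finally show ?thesis by (simp add: wedge_def scalar_mult_apply sum_distrib_left)
  qed
qed

section \<open>Signs of lists and of permutations\<close>

text \<open>
  This is \<open>(-1)\<close> to the number of inversions, with values in the coefficient ring, the only place
  where the signs of the theorem are used. In characteristic two it does not determine the integer
  sign.
\<close>

fun inversion_sign :: "nat list \<Rightarrow> 'k::comm_ring_1" where
  "inversion_sign [] = 1"
| "inversion_sign (i # is) = shuffle_sign {i} (set is) * inversion_sign is"

lemma inversion_sign_square [simp]: "inversion_sign is * inversion_sign is = 1"
proof (induction "is")
  case (Cons i "is")
  have "inversion_sign (i # is) * inversion_sign (i # is)
      = (shuffle_sign {i} (set is) * shuffle_sign {i} (set is)) * (inversion_sign is * inversion_sign is :: 'a)"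
    by (simp only: inversion_sign.simps mult_ac)
  with Cons show ?case by simp
qed simp

lemma inversion_sign_cancel:
  "inversion_sign xs * inversion_sign ys * s * (inversion_sign xs * t) * inversion_sign ys = s * t"
proof -
  have "inversion_sign xs * inversion_sign ys * s * (inversion_sign xs * t) * inversion_sign ys =
      (inversion_sign xs * inversion_sign xs) * (inversion_sign ys * inversion_sign ys) * (s * t)"
    by (simp only: mult_ac)
  then show ?thesis by simp
qed

lemma inversion_sign_append:
  "distinct (xs @ ys) \<Longrightarrow>
    inversion_sign (xs @ ys) = inversion_sign xs * inversion_sign ys * shuffle_sign (set xs) (set ys)"
proof (induction xs)
  case (Cons x xs)
  then show ?case
    using shuffle_sign_Un_left[of "{x}" "set xs" "set ys", where 'a = 'a]
      shuffle_sign_Un_right[of "{x}" "set xs" "set ys", where 'a = 'a]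
    by (auto simp: mult_ac)
qed simp

lemma inversion_sign_sorted: "sorted is \<Longrightarrow> inversion_sign is = 1"
  by (induction "is") (auto intro: shuffle_sign_sorted)

lemma wedges_basis_list:
  "distinct is \<Longrightarrow> wedges (map (\<lambda>i. basis_blade {i}) is) = inversion_sign is \<cdot> basis_blade (set is)"
  by (induction "is") (auto simp: wedge_scalar wedge_basis_blade mult.commute)

lemma wedges_basis_move:
  "wedges (map (\<lambda>i. basis_blade {i}) (j # ys @ zs)) =
    (-1) ^ length ys \<cdot> wedges (map (\<lambda>i. basis_blade {i}) (ys @ j # zs))"
proof (induction ys)
  case (Cons y ys)
  let ?b = "\<lambda>i. basis_blade {i} :: nat set \<Rightarrow> 'a"
  have "wedges (map ?b (j # (y # ys) @ zs)) = (?b j \<curlywedge> ?b y) \<curlywedge> wedges (map ?b (ys @ zs))"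
    by (simp add: wedge_assoc)
  also have "\<dots> = (-1 \<cdot> (?b y \<curlywedge> ?b j)) \<curlywedge> wedges (map ?b (ys @ zs))"
    by (subst basis_blade_anticommute) (simp add: pointwise wedge_def)
  also have "\<dots> = -1 \<cdot> (?b y \<curlywedge> wedges (map ?b (j # ys @ zs)))"
    by (simp add: wedge_assoc wedge_scalar)
  finally show ?case
    unfolding Cons.IH by (simp add: wedge_scalar)
qed simp

lemma wedges_basis_prefix:
  assumes "wedges (map (\<lambda>i. basis_blade {i}) ys) = c \<cdot> wedges (map (\<lambda>i. basis_blade {i}) zs)"
  shows "wedges (map (\<lambda>i. basis_blade {i}) (xs @ ys)) = c \<cdot> wedges (map (\<lambda>i. basis_blade {i}) (xs @ zs))"
  using assms by (induction xs) (auto simp: wedge_scalar)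

lemma wedges_basis_swap:
  "wedges (map (\<lambda>i. basis_blade {i}) (xs @ a # ys @ b # zs)) =
    -1 \<cdot> wedges (map (\<lambda>i. basis_blade {i}) (xs @ b # ys @ a # zs))"
proof (rule wedges_basis_prefix)
  let ?w = "\<lambda>is. wedges (map (\<lambda>i. basis_blade {i}) is) :: nat set \<Rightarrow> 'a"
  have "?w (a # ys @ b # zs) = (-1) ^ length ys \<cdot> ?w (ys @ a # b # zs)"
    by (rule wedges_basis_move)
  also have "?w (ys @ a # b # zs) = -1 \<cdot> ?w (ys @ b # a # zs)"
    by (rule wedges_basis_prefix) (use wedges_basis_move[of a "[b]" zs] in simp)
  also have "(-1) ^ length ys \<cdot> -1 \<cdot> ?w (ys @ b # a # zs) = -1 \<cdot> (-1) ^ length ys \<cdot> ?w (ys @ b # a # zs)"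
    by (simp add: mult.commute)
  also have "(-1) ^ length ys \<cdot> ?w (ys @ b # a # zs) = ?w (b # ys @ a # zs)"
    by (rule wedges_basis_move[symmetric])
  finally show "?w (a # ys @ b # zs) = -1 \<cdot> ?w (b # ys @ a # zs)" .
qed

lemma wedges_basis_transpose:
  assumes "a \<in> {1..l}" "b \<in> {1..l}" "a \<noteq> b"
  shows "wedges (map (\<lambda>i. basis_blade {i}) (map (q \<circ> transpose a b) [1..<Suc l])) =
    -1 \<cdot> wedges (map (\<lambda>i. basis_blade {i}) (map q [1..<Suc l]))"
  using assms
proof (induction a b rule: linorder_wlog)
  case (le a b)
  then have ab: "a < b" by simp
  have split: "[1..<Suc l] = [1..<a] @ a # [Suc a..<b] @ b # [Suc b..<Suc l]"
  proof -
    have "[1..<Suc l] = [1..<a] @ [a..<b] @ [b..<Suc l]"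
      using le(2,3) ab upt_add_eq_append[of 1 a "Suc l - a"] upt_add_eq_append[of a b "Suc l - b"] by simp
    then show ?thesis
      using le(2,3) ab by (simp add: upt_conv_Cons)
  qed
  have "map (transpose a b) [1..<a] = [1..<a]"
    "map (transpose a b) [Suc a..<b] = [Suc a..<b]"
    "map (transpose a b) [Suc b..<Suc l] = [Suc b..<Suc l]"
    using ab by (auto simp: transpose_def intro!: map_idI)
  then have "map (q \<circ> transpose a b) [1..<Suc l] =
      map q [1..<a] @ q b # map q [Suc a..<b] @ q a # map q [Suc b..<Suc l]"
    unfolding split map_append list.map map_map[symmetric] by simp
  moreover have "map q [1..<Suc l] =
      map q [1..<a] @ q a # map q [Suc a..<b] @ q b # map q [Suc b..<Suc l]"
    unfolding split by simp
  ultimately show ?case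
    using wedges_basis_swap by metis
next
  case (sym a b)
  then show ?case by (simp add: transpose_commute)
qed

text \<open>
  Composing on the right with an arbitrary \<open>q\<close> makes the induction over transpositions go through:
  the induction hypothesis is used for \<open>q\<close> composed with the new transposition.
\<close>

lemma wedges_basis_permute:
  assumes "p permutes {1..l}"
  shows "wedges (map (\<lambda>i. basis_blade {i}) (map (q \<circ> p) [1..<Suc l])) =
    of_int (sign p) \<cdot> wedges (map (\<lambda>i. basis_blade {i}) (map q [1..<Suc l]))"
  using assms finite_atLeastAtMost[of 1 l]
proof (induction arbitrary: q rule: permutes_induct)
  case id
  then show ?case by simp
next
  case (swap a b p)
  have "permutation p" using swap.hyps by (auto intro: permutation_permutes[THEN iffD2])
  then have s: "sign (transpose a b \<circ> p) = - sign p"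
    using swap.hyps by (simp add: sign_compose permutation_swap_id sign_swap_id)
  show ?case
    unfolding comp_assoc[symmetric] swap.IH[of "q \<circ> transpose a b"]
      wedges_basis_transpose[OF swap.hyps(1-3)] s
    by simp
qed

text \<open>
  Both signs are the factor by which sorting changes the product of the corresponding basis
  vectors, so they agree in the coefficient ring.
\<close>

lemma inversion_sign_permutation:
  assumes "p permutes {1..l}"
  shows "inversion_sign (map p [1..<Suc l]) = of_int (sign p)"
proof -
  have set: "set (map p [1..<Suc l]) = {1..l}"
    using permutes_image[OF assms] by (simp add: atLeastLessThanSuc_atLeastAtMost)
  have "distinct (map p [1..<Suc l])"
    using inj_on_subset[OF permutes_inj[OF assms]] by (simp add: distinct_map)
  then have "inversion_sign (map p [1..<Suc l]) \<cdot> basis_blade {1..l} =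
      wedges (map (\<lambda>i. basis_blade {i}) (map p [1..<Suc l]))"
    by (subst wedges_basis_list) (simp_all only: set)
  also have "\<dots> = of_int (sign p) \<cdot> wedges (map (\<lambda>i. basis_blade {i}) [1..<Suc l])"
    using wedges_basis_permute[OF assms, of id] by simp
  also have "wedges (map (\<lambda>i. basis_blade {i}) [1..<Suc l]) = basis_blade {1..l}"
    by (simp add: wedges_basis_list inversion_sign_sorted atLeastLessThanSuc_atLeastAtMost del: upt_Suc)
  finally show ?thesis
    by (auto simp: pointwise basis_blade_def dest: spec[of _ "{1..l}"])
qed

text \<open>
  The shift by one occurs because permutations act on \<open>{1..l}\<close> while list positions start at
  \<open>0\<close>.
\<close>

lemma list_permutes:
  assumes "distinct is" "set is = {1..length is}"
  shows "(\<lambda>k. if k \<in> {1..length is} then is ! (k - 1) else k) permutes {1..length is}"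
proof (rule bij_imp_permutes)
  have "bij_betw ((!) is \<circ> (\<lambda>k. k - 1)) {1..length is} (set is)"
    by (rule bij_betw_trans[of _ _ "{..<length is}"])
      (auto intro!: bij_betw_nth assms(1) bij_betw_byWitness[where f' = Suc])
  then show "bij_betw (\<lambda>k. if k \<in> {1..length is} then is ! (k - 1) else k) {1..length is} {1..length is}"
    unfolding assms(2) by (rule bij_betw_cong[THEN iffD1, rotated]) auto
qed auto

lemma list_sign_eq_inversion_sign:
  assumes "distinct is" "set is = {1..length is}"
  shows "of_int (list_sign is) = inversion_sign is"
proof -
  have map: "map (\<lambda>k. if k \<in> {1..length is} then is ! (k - 1) else k) [1..<Suc (length is)] = is"
    by (rule nth_equalityI) auto
  from inversion_sign_permutation[OF list_permutes[OF assms], where 'a = 'a] show ?thesis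
    unfolding map list_sign_def by (rule sym)
qed

section \<open>The regressive product in coordinates\<close>

text \<open>
  The map \<open>H\<close> in coordinates: it sends \<open>e(I)\<close> to \<open>\<sigma>(I, D - I)\<close> times the dual basis product over
  \<open>D - I\<close>.
\<close>

definition complement_map :: "nat \<Rightarrow> (nat set \<Rightarrow> 'k::comm_ring_1) \<Rightarrow> nat set \<Rightarrow> 'k"
  where "complement_map d f =
    (\<lambda>J. if J \<subseteq> {1..d} then shuffle_sign ({1..d} - J) J * f ({1..d} - J) else 0)"

definition complement_inv :: "nat \<Rightarrow> (nat set \<Rightarrow> 'k::comm_ring_1) \<Rightarrow> nat set \<Rightarrow> 'k"
  where "complement_inv d f =
    (\<lambda>J. if J \<subseteq> {1..d} then shuffle_sign J ({1..d} - J) * f ({1..d} - J) else 0)"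

text \<open>
  The regressive product in coordinates.
\<close>

definition vee :: "nat \<Rightarrow> (nat set \<Rightarrow> 'k::comm_ring_1) \<Rightarrow> (nat set \<Rightarrow> 'k) \<Rightarrow> nat set \<Rightarrow> 'k"
  where "vee d f g = complement_inv d (complement_map d f \<curlywedge> complement_map d g)"

definition grade_involution :: "(nat set \<Rightarrow> 'k::comm_ring_1) \<Rightarrow> nat set \<Rightarrow> 'k"
  where "grade_involution f = (\<lambda>K. (-1) ^ card K * f K)"

lemma complement_map_multivectors [simp]: "complement_map d f \<in> multivectors d"
  by (simp add: complement_map_def multivectors_def)

lemma complement_inv_multivectors [simp]: "complement_inv d f \<in> multivectors d"
  by (simp add: complement_inv_def multivectors_def)

lemma complement_map_linear:
  "complement_map d (f + g) = complement_map d f + complement_map d g"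
  "complement_map d (c \<cdot> f) = c \<cdot> complement_map d f"
  by (auto simp: complement_map_def pointwise algebra_simps)

lemma complement_inv_linear:
  "complement_inv d (f + g) = complement_inv d f + complement_inv d g"
  "complement_inv d (c \<cdot> f) = c \<cdot> complement_inv d f"
  by (auto simp: complement_inv_def pointwise algebra_simps)

lemma complement_inverse:
  assumes "f \<in> multivectors d"
  shows "complement_inv d (complement_map d f) = f" "complement_map d (complement_inv d f) = f"
  using assms by (auto simp: complement_map_def complement_inv_def multivectors_def double_diff fun_eq_iff)

lemma complement_map_basis:
  "I \<subseteq> {1..d} \<Longrightarrow> complement_map d (basis_blade I) =
    shuffle_sign I ({1..d} - I) \<cdot> basis_blade ({1..d} - I)"
  by (auto simp: complement_map_def basis_blade_def pointwise double_diff)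

lemma complement_inv_basis:
  "I \<subseteq> {1..d} \<Longrightarrow> complement_inv d (basis_blade I) =
    shuffle_sign ({1..d} - I) I \<cdot> basis_blade ({1..d} - I)"
  by (auto simp: complement_inv_def basis_blade_def pointwise double_diff)

lemma vee_add: "vee d (f + g) h = vee d f h + vee d g h" "vee d h (f + g) = vee d h f + vee d h g"
  by (simp_all add: vee_def complement_map_linear complement_inv_linear wedge_add)

lemma vee_scalar: "vee d (c \<cdot> f) g = c \<cdot> vee d f g" "vee d f (c \<cdot> g) = c \<cdot> vee d f g"
  by (simp_all add: vee_def complement_map_linear complement_inv_linear wedge_scalar)

lemma vee_zero [simp]: "vee d 0 g = 0" "vee d f 0 = 0"
  using vee_scalar(1)[of d 0 0 g] vee_scalar(2)[of d f 0 0] by simp_all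

lemma vee_sum:
  "vee d (\<Sum>i\<in>A. F i) g = (\<Sum>i\<in>A. vee d (F i) g)"
  "vee d g (\<Sum>i\<in>A. F i) = (\<Sum>i\<in>A. vee d g (F i))"
  by (induction A rule: infinite_finite_induct) (auto simp: vee_add)

lemma vee_multivectors [simp]: "vee d f g \<in> multivectors d"
  by (simp add: vee_def)

lemma grade_involution_linear:
  "grade_involution (f + g) = grade_involution f + grade_involution g"
  "grade_involution (c \<cdot> f) = c \<cdot> grade_involution f"
  by (auto simp: grade_involution_def pointwise algebra_simps)

lemma grade_involution_zero [simp]: "grade_involution 0 = 0"
  by (auto simp: grade_involution_def pointwise)

lemma grade_involution_sum: "grade_involution (\<Sum>i\<in>A. F i) = (\<Sum>i\<in>A. grade_involution (F i))"
  by (induction A rule: infinite_finite_induct) (auto simp: grade_involution_linear)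

lemma grade_involution_homogeneous: "homogeneous d l f \<Longrightarrow> grade_involution f = (-1) ^ l \<cdot> f"
  unfolding grade_involution_def homogeneous_def pointwise by (metis mult_zero_right)

lemma grade_involution_basis: "grade_involution (basis_blade I) = (-1) ^ card I \<cdot> basis_blade I"
  by (auto simp: grade_involution_def basis_blade_def pointwise)

text \<open>
  With \<open>m = P \<inter> Q\<close>, \<open>a = D - P\<close>, \<open>b = D - Q\<close> the sets \<open>m, a, b\<close> partition \<open>D\<close>, and splitting the
  four signs that arise along this partition cancels all of them in pairs except \<open>\<sigma>(b, a)\<close>.
\<close>

lemma vee_basis:
  assumes P: "P \<subseteq> {1..d}" and Q: "Q \<subseteq> {1..d}"
  shows "vee d (basis_blade P) (basis_blade Q) =
    (if P \<union> Q = {1..d} then shuffle_sign ({1..d} - Q) ({1..d} - P) \<cdot> basis_blade (P \<inter> Q)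
     else (0 :: nat set \<Rightarrow> 'k::comm_ring_1))"
proof (cases "P \<union> Q = {1..d}")
  case False
  then have "({1..d} - P) \<inter> ({1..d} - Q) \<noteq> {}" using P Q by auto
  with False have "complement_map d (basis_blade P) \<curlywedge> complement_map d (basis_blade Q) = (0 :: nat set \<Rightarrow> 'k)"
    by (simp add: complement_map_basis P Q wedge_scalar wedge_basis_blade)
  with False show ?thesis
    using complement_inv_linear(2)[of d 0 0] by (simp add: vee_def)
next
  case True
  define D where "D = {1..d}"
  define m a b where "m = P \<inter> Q" and "a = D - P" and "b = D - Q"
  have fin: "finite m" "finite a" "finite b" using P unfolding m_def a_def b_def D_def
    by (auto intro: finite_subset)
  have disj: "m \<inter> a = {}" "m \<inter> b = {}" "a \<inter> b = {}"
    using True unfolding m_def a_def b_def D_def by auto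
  have PQ: "P = b \<union> m" "Q = a \<union> m" "D - (a \<union> b) = m"
    using True unfolding m_def a_def b_def D_def by auto
  have ab: "a \<union> b \<subseteq> {1..d}" by (auto simp: a_def b_def D_def)
  have "vee d (basis_blade P) (basis_blade Q) =
     (shuffle_sign P a * (shuffle_sign Q b * (shuffle_sign a b * shuffle_sign m (a \<union> b))))
     \<cdot> (basis_blade m :: nat set \<Rightarrow> 'k)"
    using disj fin complement_map_basis[OF P, where 'a = 'k] complement_map_basis[OF Q, where 'a = 'k]
      complement_inv_basis[OF ab, where 'a = 'k]
    unfolding D_def[symmetric] a_def[symmetric] b_def[symmetric] PQ(3)
    by (simp add: vee_def wedge_scalar wedge_basis_blade complement_inv_linear mult_ac)
  also have "shuffle_sign P a * (shuffle_sign Q b * (shuffle_sign a b * shuffle_sign m (a \<union> b))) =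
      (shuffle_sign b a :: 'k)"
    using disj fin unfolding PQ
    by (simp add: shuffle_sign_Un_left shuffle_sign_Un_right Int_commute mult_ac)
  finally show ?thesis using True by (simp flip: D_def a_def b_def m_def)
qed

lemma basis_blade_singleton_wedge:
  "finite I \<Longrightarrow> basis_blade {i} \<curlywedge> basis_blade I =
    (if i \<in> I then 0 else shuffle_sign {i} I \<cdot> basis_blade (insert i I))"
  "finite I \<Longrightarrow> basis_blade I \<curlywedge> basis_blade {i} =
    (if i \<in> I then 0 else shuffle_sign I {i} \<cdot> basis_blade (insert i I))"
  by (auto simp: wedge_basis_blade)

text \<open>
  The Leibniz rule on basis elements. If \<open>i\<close> lies in both \<open>P\<close> and \<open>Q\<close>, or \<open>P \<union> Q\<close> together with
  \<open>i\<close> misses part of \<open>D\<close>, then all terms vanish. Otherwise exactly two terms survive, and their signs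
  are compared by splitting along \<open>m = P \<inter> Q\<close> and the complements of \<open>P\<close> and \<open>Q\<close> without \<open>i\<close>.
\<close>

lemma vee_wedge_basis:
  assumes P: "P \<subseteq> {1..d}" and Q: "Q \<subseteq> {1..d}" and i: "i \<in> {1..d}"
  shows "vee d (basis_blade P \<curlywedge> basis_blade {i}) (basis_blade Q) =
    vee d (basis_blade P) (basis_blade Q) \<curlywedge> basis_blade {i} +
    grade_involution (vee d (basis_blade P) (basis_blade {i} \<curlywedge> basis_blade Q) :: nat set \<Rightarrow> 'k::comm_ring_1)"
proof -
  define D where "D = {1..d}"
  define m a b where "m = P \<inter> Q" and "a = D - P - {i}" and "b = D - Q - {i}"
  have finPQ: "finite P" "finite Q" using P Q finite_subset by blast+
  have fin: "finite m" "finite a" "finite b" unfolding m_def a_def b_def D_def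
    using finPQ by auto
  have ins: "insert i P \<subseteq> {1..d}" "insert i Q \<subseteq> {1..d}" using P Q i by auto
  consider "i \<in> P" "i \<in> Q" | "insert i (P \<union> Q) \<noteq> D"
    | "insert i (P \<union> Q) = D" "i \<in> P" "i \<notin> Q" | "insert i (P \<union> Q) = D" "i \<notin> P" "i \<in> Q"
    | "insert i (P \<union> Q) = D" "i \<notin> P" "i \<notin> Q" by blast
  then show ?thesis
  proof cases
    case 1
    then show ?thesis
      using finPQ i by (simp add: basis_blade_singleton_wedge vee_basis P Q wedge_scalar)
  next
    case 2
    have "P \<union> Q \<noteq> {1..d}" "insert i P \<union> Q \<noteq> {1..d}" "P \<union> insert i Q \<noteq> {1..d}"
      using 2 i unfolding D_def by (metis insert_absorb Un_insert_left Un_insert_right)+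
    then show ?thesis
      using finPQ i by (simp add: basis_blade_singleton_wedge vee_basis vee_scalar P Q ins)
  next
    case 3
    have "P \<union> Q = {1..d}" "P \<union> insert i Q = {1..d}" "{1..d} - P = a" "{1..d} - Q = insert i b"
      "{1..d} - insert i Q = b" "P \<inter> insert i Q = insert i m" "P \<inter> Q = m" and Qam: "Q = a \<union> m"
      and d: "a \<inter> m = {}" "i \<notin> m" "i \<notin> a" "i \<notin> b"
      using 3 P Q i unfolding m_def a_def b_def D_def by auto
    note this(1-7)
    moreover have "shuffle_sign (insert i b) a = (shuffle_sign {i} a * shuffle_sign b a :: 'k)"
      using shuffle_sign_Un_left[of "{i}" b a] fin d by simp
    moreover have "shuffle_sign {i} Q = (shuffle_sign {i} a * shuffle_sign {i} m :: 'k)"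
      using shuffle_sign_Un_right[of "{i}" a m] fin d Qam by simp
    moreover have "shuffle_sign m {i} = ((-1) ^ card m * shuffle_sign {i} m :: 'k)"
      using shuffle_sign_swap[of "{i}" m] fin d by simp
    ultimately show ?thesis
      using finPQ i fin 3(2,3) d
      by (simp add: basis_blade_singleton_wedge vee_basis vee_scalar P Q ins wedge_scalar
          grade_involution_linear grade_involution_basis mult_ac) (simp add: pointwise)
  next
    case 4
    have "P \<union> Q = {1..d}" "insert i P \<union> Q = {1..d}" "{1..d} - P = insert i a" "{1..d} - Q = b"
      "{1..d} - insert i P = a" "insert i P \<inter> Q = insert i m" "P \<inter> Q = m" and Pbm: "P = b \<union> m"
      and d: "b \<inter> m = {}" "i \<notin> m" "i \<notin> a" "i \<notin> b"
      using 4 P Q i unfolding m_def a_def b_def D_def by auto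
    note this(1-7)
    moreover have "shuffle_sign b (insert i a) = (shuffle_sign b {i} * shuffle_sign b a :: 'k)"
      using shuffle_sign_Un_right[of b "{i}" a] fin d by simp
    moreover have "shuffle_sign P {i} = (shuffle_sign b {i} * shuffle_sign m {i} :: 'k)"
      using shuffle_sign_Un_left[of b m "{i}"] fin d Pbm by simp
    ultimately show ?thesis
      using finPQ i fin 4(2,3) d
      by (simp add: basis_blade_singleton_wedge vee_basis vee_scalar P Q ins wedge_scalar mult_ac)
  next
    case 5
    have "P \<union> Q \<noteq> {1..d}" "insert i P \<union> Q = {1..d}" "P \<union> insert i Q = {1..d}"
      "{1..d} - P = insert i a" "{1..d} - Q = insert i b" "{1..d} - insert i P = a"
      "{1..d} - insert i Q = b" "insert i P \<inter> Q = m" "P \<inter> insert i Q = m"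
      and Pbm: "P = b \<union> m" and Qam: "Q = a \<union> m"
      and d: "b \<inter> m = {}" "a \<inter> m = {}" "i \<notin> m" "i \<notin> a" "i \<notin> b"
      using 5 P Q i unfolding m_def a_def b_def D_def by auto
    note this(1-9)
    moreover have "shuffle_sign b (insert i a) = (shuffle_sign b {i} * shuffle_sign b a :: 'k)"
      using shuffle_sign_Un_right[of b "{i}" a] fin d by simp
    moreover have "shuffle_sign (insert i b) a = (shuffle_sign {i} a * shuffle_sign b a :: 'k)"
      using shuffle_sign_Un_left[of "{i}" b a] fin d by simp
    moreover have "shuffle_sign P {i} = (shuffle_sign b {i} * shuffle_sign m {i} :: 'k)"
      using shuffle_sign_Un_left[of b m "{i}"] fin d Pbm by simp
    moreover have "shuffle_sign {i} Q = (shuffle_sign {i} a * shuffle_sign {i} m :: 'k)"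
      using shuffle_sign_Un_right[of "{i}" a m] fin d Qam by simp
    moreover have "shuffle_sign m {i} = ((-1) ^ card m * shuffle_sign {i} m :: 'k)"
      using shuffle_sign_swap[of "{i}" m] fin d by simp
    ultimately show ?thesis
      using finPQ i fin 5(2,3) d
      by (simp add: basis_blade_singleton_wedge vee_basis vee_scalar P Q ins wedge_scalar
          grade_involution_linear grade_involution_basis mult_ac)
  qed
qed

lemma vee_wedge_vec:
  assumes f: "f \<in> multivectors d" and g: "g \<in> multivectors d"
  shows "vee d (f \<curlywedge> vec d a) g =
    vee d f g \<curlywedge> vec d a + grade_involution (vee d f (vec d a \<curlywedge> g))"
proof -
  have "vee d (f \<curlywedge> basis_blade {i}) g =
      vee d f g \<curlywedge> basis_blade {i} + grade_involution (vee d f (basis_blade {i} \<curlywedge> g))"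
    if i: "i \<in> {1..d}" for i
  proof -
    have "vee d (basis_blade P \<curlywedge> basis_blade {i}) g =
        vee d (basis_blade P) g \<curlywedge> basis_blade {i} +
        grade_involution (vee d (basis_blade P) (basis_blade {i} \<curlywedge> g))" if P: "P \<subseteq> {1..d}" for P
      using g
    proof (induction rule: multivectors_induct)
      case (blade Q)
      then show ?case by (rule vee_wedge_basis[OF P _ i])
    qed (simp_all add: wedge_add wedge_scalar vee_add vee_scalar grade_involution_linear
        scalar_mult_add add_ac)
    with f show ?thesis
      by (induction rule: multivectors_induct)
        (simp_all add: wedge_add wedge_scalar vee_add vee_scalar grade_involution_linear
          scalar_mult_add add_ac)
  qed
  then show ?thesis
    by (simp add: vec_def wedge_sum wedge_scalar vee_sum vee_scalar grade_involution_sum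
        grade_involution_linear sum.distrib[symmetric] flip: scalar_mult_add)
qed

text \<open>
  The product \<open>u(I)\<close> in increasing order, where \<open>a k\<close> are the coordinates of \<open>u k\<close>.
\<close>

definition wedge_of :: "nat \<Rightarrow> (nat \<Rightarrow> nat \<Rightarrow> 'k::comm_ring_1) \<Rightarrow> nat set \<Rightarrow> nat set \<Rightarrow> 'k"
  where "wedge_of d a I = wedges (map (\<lambda>k. vec d (a k)) (sorted_list_of_set I))"

lemma homogeneous_wedge_of: "homogeneous d (card I) (wedge_of d a I)"
proof -
  have "homogeneous d 1 f" if "f \<in> set (map (\<lambda>k. vec d (a k)) (sorted_list_of_set I))" for f
    using that homogeneous_vec by auto
  then have "homogeneous d (length (map (\<lambda>k. vec d (a k)) (sorted_list_of_set I))) (wedge_of d a I)"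
    unfolding wedge_of_def by (rule homogeneous_wedges)
  then show ?thesis by simp
qed

lemma wedge_of_multivectors [simp]: "wedge_of d a I \<in> multivectors d"
  by (rule homogeneous_multivectors[OF homogeneous_wedge_of])

lemma wedge_of_insert_max:
  assumes "I \<subseteq> {1..l}"
  shows "wedge_of d a (insert (Suc l) I) = wedge_of d a I \<curlywedge> vec d (a (Suc l))"
proof -
  have fin: "finite I" using assms finite_subset by blast
  have new: "Suc l \<notin> I" using assms by auto
  have "sorted_wrt (<) (sorted_list_of_set I @ [Suc l])"
    using assms fin by (auto simp: sorted_wrt_append less_Suc_eq_le)
  then have "sorted_list_of_set (insert (Suc l) I) = sorted_list_of_set I @ [Suc l]"
    using fin new by (intro sorted_list_of_set_unique[THEN iffD1]) auto
  then show ?thesis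
    unfolding wedge_of_def
    by (simp, subst wedges_append[where d = d]) (auto simp: wedge_unit[OF vec_multivectors])
qed

text \<open>
  Induction on the number of factors by the Leibniz rule. A set \<open>I\<close> containing the last index stands
  for keeping the last factor, which costs no sign since that index is the largest; otherwise the factor
  goes over to \<open>g\<close>, and the grade involution contributes \<open>(-1)\<close> to the number of kept factors, which
  is the number of new inversions. Subsets of every size are summed here, since \<open>g\<close> need not be
  homogeneous.
\<close>

lemma vee_expansion:
  assumes "g \<in> multivectors d"
  shows "vee d (wedge_of d a {1..l}) g =
    (\<Sum>I\<in>Pow {1..l}. (shuffle_sign ({1..l} - I) I * (wedge_of d a ({1..l} - I) \<curlywedge> g) {1..d}) \<cdot> wedge_of d a I)"
  using assms
proof (induction l arbitrary: g)
  case 0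
  have "vee d (basis_blade {}) g = g {1..d} \<cdot> basis_blade {}"
    using 0
  proof (induction rule: multivectors_induct)
    case (blade Q)
    then show ?case by (subst vee_basis) (auto simp: basis_blade_def)
  qed (simp_all add: vee_add vee_scalar scalar_mult_add
      plus_fun_apply[of _ _ "{1..d}"] scalar_mult_apply[of _ _ "{1..d}"])
  with 0 show ?case by (simp add: wedge_of_def)
next
  case (Suc l)
  let ?v = "vec d (a (Suc l))" and ?w = "wedge_of d a"
  let ?S = "{1..Suc l}" and ?L = "{1..l}"
  let ?t = "\<lambda>I. (shuffle_sign (?S - I) I * (?w (?S - I) \<curlywedge> g) {1..d}) \<cdot> ?w I"
  have S: "?S = insert (Suc l) ?L" by auto
  have kept: "?t (insert (Suc l) I) =
      ((shuffle_sign (?L - I) I * (?w (?L - I) \<curlywedge> g) {1..d}) \<cdot> ?w I) \<curlywedge> ?v" if I: "I \<subseteq> ?L" for I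
  proof -
    have fin: "finite I" using I finite_subset by blast
    have new: "Suc l \<notin> I" using I by auto
    have "?S - insert (Suc l) I = ?L - I" by auto
    moreover have "shuffle_sign (?L - I) (insert (Suc l) I) = (shuffle_sign (?L - I) I :: 'a)"
      using shuffle_sign_Un_right[of "?L - I" I "{Suc l}", where 'a = 'a] I fin
        shuffle_sign_sorted[of "?L - I" "{Suc l}", where 'a = 'a] new by (auto simp: subset_eq)
    ultimately show ?thesis
      using wedge_of_insert_max[OF I, of d a] by (simp add: wedge_scalar)
  qed
  have dropped: "?t I = grade_involution
      ((shuffle_sign (?L - I) I * (?w (?L - I) \<curlywedge> (?v \<curlywedge> g)) {1..d}) \<cdot> ?w I)" if I: "I \<subseteq> ?L" for I
  proof -
    have fin: "finite I" using I finite_subset by blast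
    have "?S - I = insert (Suc l) (?L - I)" using I by auto
    moreover have "shuffle_sign (insert (Suc l) (?L - I)) I = ((-1) ^ card I * shuffle_sign (?L - I) I :: 'a)"
    proof -
      have "{j \<in> I. j < Suc l} = I" using I by auto
      then show ?thesis
        using shuffle_sign_Un_left[of "{Suc l}" "?L - I" I, where 'a = 'a] fin
        by (simp add: shuffle_sign_singleton)
    qed
    moreover have "?w (insert (Suc l) (?L - I)) = ?w (?L - I) \<curlywedge> ?v"
      by (rule wedge_of_insert_max) auto
    ultimately show ?thesis
      by (simp add: wedge_assoc grade_involution_linear
          grade_involution_homogeneous[OF homogeneous_wedge_of] mult_ac)
  qed
  have "vee d (?w ?S) g = vee d (?w ?L \<curlywedge> ?v) g"
    unfolding S by (subst wedge_of_insert_max) auto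
  also have "\<dots> = vee d (?w ?L) g \<curlywedge> ?v + grade_involution (vee d (?w ?L) (?v \<curlywedge> g))"
    using Suc.prems by (simp add: vee_wedge_vec)
  also have "vee d (?w ?L) g \<curlywedge> ?v = (\<Sum>I\<in>Pow ?L. ?t (insert (Suc l) I))"
    unfolding Suc.IH[OF Suc.prems] wedge_sum by (rule sum.cong) (auto simp: kept simp del: insert_iff)
  also have "grade_involution (vee d (?w ?L) (?v \<curlywedge> g)) = (\<Sum>I\<in>Pow ?L. ?t I)"
    using Suc.prems by (subst Suc.IH) (auto simp: grade_involution_sum dropped intro!: sum.cong)
  also have "(\<Sum>I\<in>Pow ?L. ?t (insert (Suc l) I)) = (\<Sum>I\<in>insert (Suc l) ` Pow ?L. ?t I)"
    by (subst sum.reindex) (auto simp: inj_on_def dest!: insert_ident[THEN iffD1, rotated 2])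
  also have "\<dots> + (\<Sum>I\<in>Pow ?L. ?t I) = (\<Sum>I\<in>Pow ?S. ?t I)"
    unfolding S Pow_insert by (subst sum.union_disjoint) (auto simp: add.commute)
  finally show ?case .
qed

lemma homogeneous_top: "homogeneous d k f \<Longrightarrow> k \<noteq> d \<Longrightarrow> f {1..d} = 0"
  by (fastforce simp: homogeneous_def)

lemma homogeneous_vanish: "homogeneous d k f \<Longrightarrow> d < k \<Longrightarrow> f = 0"
  unfolding homogeneous_def pointwise
  by (metis card_atLeastAtMost card_mono diff_Suc_1 finite_atLeastAtMost leD)

text \<open>
  For homogeneous \<open>g\<close> the coefficient at \<open>D\<close> vanishes for degree reasons unless \<open>I\<close> has
  \<open>l + m - d\<close> elements.
\<close>

lemma vee_expansion_left:
  assumes g: "homogeneous d m g" and "d \<le> l + m"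
  shows "vee d (wedge_of d a {1..l}) g =
    (\<Sum>I | I \<subseteq> {1..l} \<and> card I = l + m - d.
      (shuffle_sign ({1..l} - I) I * (wedge_of d a ({1..l} - I) \<curlywedge> g) {1..d}) \<cdot> wedge_of d a I)"
  unfolding vee_expansion[OF homogeneous_multivectors[OF g]]
proof (rule sum.mono_neutral_right)
  show "\<forall>I\<in>Pow {1..l} - {I. I \<subseteq> {1..l} \<and> card I = l + m - d}.
      (shuffle_sign ({1..l} - I) I * (wedge_of d a ({1..l} - I) \<curlywedge> g) {1..d}) \<cdot> wedge_of d a I = 0"
  proof
    fix I assume I: "I \<in> Pow {1..l} - {I. I \<subseteq> {1..l} \<and> card I = l + m - d}"
    then have "card I \<le> l" using card_mono[of "{1..l}" I] by auto
    moreover have "card ({1..l} - I) = l - card I"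
      using I by (subst card_Diff_subset) (auto intro: finite_subset)
    ultimately have "card ({1..l} - I) + m \<noteq> d" using I \<open>d \<le> l + m\<close> by auto
    then have "(wedge_of d a ({1..l} - I) \<curlywedge> g) {1..d} = 0"
      by (rule homogeneous_top[OF homogeneous_wedge[OF homogeneous_wedge_of g]])
    then show "(shuffle_sign ({1..l} - I) I * (wedge_of d a ({1..l} - I) \<curlywedge> g) {1..d}) \<cdot> wedge_of d a I = 0"
      by simp
  qed
qed auto

lemma vee_graded_commute:
  assumes f: "homogeneous d l f" and g: "homogeneous d m g" and "l \<le> d" "m \<le> d"
  shows "vee d f g = (-1) ^ ((d - l) * (d - m)) \<cdot> vee d g f"
proof -
  have "homogeneous d (d - k) (complement_map d h)" if "homogeneous d k h" for k and h :: "nat set \<Rightarrow> 'a"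
    unfolding homogeneous_def
  proof (intro allI impI)
    fix J assume "complement_map d h J \<noteq> 0"
    then have J: "J \<subseteq> {1..d}" "h ({1..d} - J) \<noteq> 0"
      by (auto simp: complement_map_def split: if_splits)
    with that have "card ({1..d} - J) = k" by (auto simp: homogeneous_def)
    moreover have "card J \<le> d" using J card_mono[of "{1..d}" J] by auto
    moreover have "card ({1..d} - J) = d - card J"
      using J by (subst card_Diff_subset) (auto intro: finite_subset)
    ultimately show "J \<subseteq> {1..d} \<and> card J = d - k" using J by auto
  qed
  from wedge_graded_commute[OF this[OF g] this[OF f]] show ?thesis
    by (simp add: vee_def complement_inv_linear mult.commute)
qed

text \<open>
  Exchanging the factors in each bracket and the two parts of each shuffle changes every summand of
  \<open>vee_expansion_left\<close> by the same sign, which is also the one from exchanging the factors of the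
  regressive product. If a degree exceeds \<open>d\<close>, that factor is zero.
\<close>

lemma vee_expansion_right:
  assumes f: "homogeneous d l f" and "d \<le> l + m"
  shows "vee d f (wedge_of d a {1..m}) =
    (\<Sum>I | I \<subseteq> {1..m} \<and> card I = l + m - d.
      (shuffle_sign I ({1..m} - I) * (f \<curlywedge> wedge_of d a ({1..m} - I)) {1..d}) \<cdot> wedge_of d a I)"
proof (cases "l \<le> d")
  case False
  with f have "f = 0" by (intro homogeneous_vanish) auto
  then show ?thesis by (simp add: zero_fun_apply[of "{1..d}"])
next
  case True
  define s where "s = (l + m - d) * (d - l) + l * (d - l)"
  have "vee d f (wedge_of d a {1..m}) = (-1) ^ s \<cdot> vee d (wedge_of d a {1..m}) f"
  proof (cases "m \<le> d")
    case False
    then have "wedge_of d a {1..m} = 0"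
      using homogeneous_wedge_of[of d "{1..m}" a] by (intro homogeneous_vanish) auto
    then show ?thesis by simp
  next
    case m: True
    have "even ((d - l) * (d - m)) = even s"
      using True m assms(2) by (auto simp: s_def even_add)
    then have "(-1) ^ ((d - l) * (d - m)) = ((-1) ^ s :: 'a)"
      by (simp add: minus_one_power_iff)
    then show ?thesis
      using vee_graded_commute[OF f homogeneous_wedge_of[of d "{1..m}" a]] True m by simp
  qed
  also have "\<dots> = (\<Sum>I | I \<subseteq> {1..m} \<and> card I = l + m - d.
      (shuffle_sign I ({1..m} - I) * (f \<curlywedge> wedge_of d a ({1..m} - I)) {1..d}) \<cdot> wedge_of d a I)"
    unfolding vee_expansion_left[OF f, of m a, unfolded add.commute[of m l], OF assms(2)] scalar_mult_sum
  proof (rule sum.cong)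
    fix I assume "I \<in> {I. I \<subseteq> {1..m} \<and> card I = l + m - d}"
    then have I: "I \<subseteq> {1..m}" "card I = l + m - d" by auto
    have fin: "finite I" using I finite_subset by blast
    have c: "card ({1..m} - I) = d - l"
      using I True assms(2) fin by (subst card_Diff_subset) auto
    have sh: "shuffle_sign ({1..m} - I) I =
        ((-1) ^ ((l + m - d) * (d - l)) * shuffle_sign I ({1..m} - I) :: 'a)"
      using shuffle_sign_swap[of I "{1..m} - I", where 'a = 'a] fin I c by auto
    have w: "wedge_of d a ({1..m} - I) \<curlywedge> f = (-1) ^ (l * (d - l)) \<cdot> (f \<curlywedge> wedge_of d a ({1..m} - I))"
      using wedge_graded_commute[OF f homogeneous_wedge_of[of d "{1..m} - I" a]] c by simp
    have "(-1) ^ s * ((-1) ^ ((l + m - d) * (d - l)) * (-1) ^ (l * (d - l))) = (1 :: 'a)"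
      unfolding s_def power_add[symmetric] by (simp flip: mult_2)
    then have e: "(-1) ^ s * (((-1) ^ ((l + m - d) * (d - l)) * b) * ((-1) ^ (l * (d - l)) * c)) = b * c"
      for b c :: 'a by (metis (no_types, lifting) mult.assoc mult.commute mult_1)
    show "(-1) ^ s \<cdot>
        (shuffle_sign ({1..m} - I) I * (wedge_of d a ({1..m} - I) \<curlywedge> f) {1..d}) \<cdot> wedge_of d a I =
      (shuffle_sign I ({1..m} - I) * (f \<curlywedge> wedge_of d a ({1..m} - I)) {1..d}) \<cdot> wedge_of d a I"
      unfolding sh w scalar_mult_apply scalar_mult_simps e ..
  qed simp
  finally show ?thesis .
qed

section \<open>Coordinates on the exterior algebra\<close>

text \<open>
  A subspace \<open>S\<close> of a possibly larger type with basis \<open>x 1, \<dots>, x d\<close> and coordinate functions \<open>c\<close>.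
  The subset is needed for the dual space, which is not a whole type.
\<close>

locale exterior_coordinates =
  fixes scale :: "'k::field \<Rightarrow> 'v::ab_group_add \<Rightarrow> 'v" and S :: "'v set"
    and x :: "nat \<Rightarrow> 'v" and d :: nat and c :: "'v \<Rightarrow> nat \<Rightarrow> 'k"
  assumes zero_S: "0 \<in> S"
    and add_S: "a \<in> S \<Longrightarrow> b \<in> S \<Longrightarrow> a + b \<in> S"
    and scale_S: "a \<in> S \<Longrightarrow> scale r a \<in> S"
    and x_S: "i \<in> {1..d} \<Longrightarrow> x i \<in> S"
    and c_add: "a \<in> S \<Longrightarrow> b \<in> S \<Longrightarrow> c (a + b) i = c a i + c b i"
    and c_scale: "a \<in> S \<Longrightarrow> c (scale r a) i = r * c a i"
    and c_x: "i \<in> {1..d} \<Longrightarrow> j \<in> {1..d} \<Longrightarrow> c (x i) j = (if j = i then 1 else 0)"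
    and expand: "v \<in> S \<Longrightarrow> v = (\<Sum>i\<in>{1..d}. scale (c v i) (x i))"
begin

abbreviation FA :: "('v word \<Rightarrow>\<^sub>0 'k) ring" where "FA \<equiv> free_algebra S"
abbreviation J where "J \<equiv> exterior_ideal scale S"
abbreviation E where "E \<equiv> exterior_algebra scale S"
abbreviation V where "V v \<equiv> vec d (c v)"

definition word_product :: "'v list \<Rightarrow> ('v word \<Rightarrow>\<^sub>0 'k)"
  where "word_product vs = prod_list (map letter vs)"

text \<open>
  The algebra homomorphism from the free algebra to the coordinate model that sends each letter to
  the vector it names.
\<close>

definition eval_free :: "('v word \<Rightarrow>\<^sub>0 'k) \<Rightarrow> nat set \<Rightarrow> 'k"
  where "eval_free p = (\<Sum>w\<in>Poly_Mapping.keys p. Poly_Mapping.lookup p w \<cdot> wedges (map V (letters w)))"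

text \<open>
  The section of the evaluation that writes a multivector as a combination of sorted words in the
  basis.
\<close>

definition normal_form :: "(nat set \<Rightarrow> 'k) \<Rightarrow> ('v word \<Rightarrow>\<^sub>0 'k)"
  where "normal_form f =
    (\<Sum>I\<in>Pow {1..d}. const_poly (f I) * word_product (map x (sorted_list_of_set I)))"

section \<open>The free algebra\<close>

lemma FA_simps: "p \<otimes>\<^bsub>FA\<^esub> q = p * q" "p \<oplus>\<^bsub>FA\<^esub> q = p + q" "\<one>\<^bsub>FA\<^esub> = 1" "\<zero>\<^bsub>FA\<^esub> = 0"
  by (simp_all add: free_algebra_def)

sublocale FA: ring FA by (rule ring_free_algebra)

lemma FA_add [intro, simp]: "p \<in> carrier FA \<Longrightarrow> q \<in> carrier FA \<Longrightarrow> p + q \<in> carrier FA"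
  using FA.a_closed by (simp add: FA_simps)

lemma FA_mult [intro, simp]: "p \<in> carrier FA \<Longrightarrow> q \<in> carrier FA \<Longrightarrow> p * q \<in> carrier FA"
  using FA.m_closed by (simp add: FA_simps)

lemma FA_zero [simp]: "0 \<in> carrier FA" and FA_one [simp]: "1 \<in> carrier FA"
  using FA.zero_closed FA.one_closed by (simp_all add: FA_simps)

lemma FA_letter [simp]: "v \<in> S \<Longrightarrow> letter v \<in> carrier FA"
  by (simp add: free_algebra_def letter_def)

lemma FA_const [simp]: "const_poly r \<in> carrier FA"
  by (simp add: free_algebra_def const_poly_def zero_word_def)

lemma FA_diff [simp]: "p \<in> carrier FA \<Longrightarrow> q \<in> carrier FA \<Longrightarrow> p - q \<in> carrier FA"
  using Poly_Mapping.keys_diff[of p q] by (fastforce simp: free_algebra_def)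

lemma FA_sum [simp]: "(\<And>i. i \<in> A \<Longrightarrow> F i \<in> carrier FA) \<Longrightarrow> (\<Sum>i\<in>A. F i) \<in> carrier FA"
  by (induction A rule: infinite_finite_induct) auto

lemma word_product_simps [simp]:
  "word_product [] = 1" "word_product (v # vs) = letter v * word_product vs"
  by (simp_all add: word_product_def)

lemma FA_word_product [simp]: "set vs \<subseteq> S \<Longrightarrow> word_product vs \<in> carrier FA"
  by (induction vs) auto

lemma word_product_single: "word_product vs = Poly_Mapping.single (Word vs) 1"
proof (induction vs)
  case Nil
  then show ?case by (metis single_one word_product_simps(1) zero_word_def)
next
  case (Cons v vs)
  then show ?case by (simp add: letter_def mult_single plus_word_def)
qed

lemma const_word_product: "const_poly r * word_product vs = Poly_Mapping.single (Word vs) r"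
  by (simp add: word_product_single const_poly_def mult_single zero_word_def plus_word_def)

lemma const_poly_simps:
  "const_poly 0 = 0" "const_poly 1 = 1" "const_poly (a + b) = const_poly a + const_poly b"
  "const_poly (a * b) = const_poly a * const_poly b" "const_poly (- a) = - const_poly a"
  by (simp_all add: const_poly_def single_add mult_single single_uminus)

text \<open>
  Reduces additive statements about the free algebra to scalar multiples of words.
\<close>

lemma FA_induct [consumes 1, case_names add word]:
  assumes p: "p \<in> carrier FA"
    and add: "\<And>p q. p \<in> carrier FA \<Longrightarrow> q \<in> carrier FA \<Longrightarrow> P p \<Longrightarrow> P q \<Longrightarrow> P (p + q)"
    and word: "\<And>r vs. set vs \<subseteq> S \<Longrightarrow> P (const_poly r * word_product vs)"
  shows "P p"
proof -
  have word': "P (Poly_Mapping.single w r)" if "set (letters w) \<subseteq> S" for w r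
    using word[OF that, of r] by (simp add: const_word_product)
  have keys: "set (letters w) \<subseteq> S" if "w \<in> Poly_Mapping.keys p" for w
    using p that by (auto simp: free_algebra_def)
  have "(\<Sum>w\<in>A. Poly_Mapping.single w (Poly_Mapping.lookup p w)) \<in> carrier FA \<and>
      P (\<Sum>w\<in>A. Poly_Mapping.single w (Poly_Mapping.lookup p w))"
    if "finite A" "A \<subseteq> Poly_Mapping.keys p" for A
    using that
  proof (induction A rule: finite_induct)
    case empty
    then show ?case using word'[of "Word []" 0] by simp
  next
    case (insert w A)
    have "Poly_Mapping.single w (Poly_Mapping.lookup p w) \<in> carrier FA"
      using keys[of w] insert by (auto simp: free_algebra_def)
    then show ?case
      using insert keys[of w] by (auto intro!: add word')
  qed
  from this[of "Poly_Mapping.keys p"]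
  have "P (\<Sum>w\<in>Poly_Mapping.keys p. Poly_Mapping.single w (Poly_Mapping.lookup p w))" by simp
  also have "(\<Sum>w\<in>Poly_Mapping.keys p. Poly_Mapping.single w (Poly_Mapping.lookup p w)) = p"
    by (rule poly_mapping_eqI)
      (auto simp: lookup_sum lookup_single when_def in_keys_iff cong: if_cong)
  finally show ?thesis .
qed

lemma const_poly_commute: "p \<in> carrier FA \<Longrightarrow> p * const_poly r = const_poly r * p"
proof (induction rule: FA_induct)
  case (word s vs)
  then show ?case
    unfolding const_word_product
    by (simp add: const_poly_def mult_single zero_word_def plus_word_def mult.commute)
qed (simp add: algebra_simps)

section \<open>Evaluation in the model\<close>

lemma eval_free_superset:
  "finite A \<Longrightarrow> Poly_Mapping.keys p \<subseteq> A \<Longrightarrow>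
    eval_free p = (\<Sum>w\<in>A. Poly_Mapping.lookup p w \<cdot> wedges (map V (letters w)))"
  unfolding eval_free_def by (rule sum.mono_neutral_left) (auto simp: in_keys_iff)

lemma eval_free_add: "eval_free (p + q) = eval_free p + eval_free q"
proof -
  let ?A = "Poly_Mapping.keys p \<union> Poly_Mapping.keys q"
  have "eval_free (p + q) = (\<Sum>w\<in>?A. Poly_Mapping.lookup (p + q) w \<cdot> wedges (map V (letters w)))"
    by (rule eval_free_superset) (use Poly_Mapping.keys_add[of p q] in auto)
  moreover have "eval_free p = (\<Sum>w\<in>?A. Poly_Mapping.lookup p w \<cdot> wedges (map V (letters w)))"
    "eval_free q = (\<Sum>w\<in>?A. Poly_Mapping.lookup q w \<cdot> wedges (map V (letters w)))"
    by (rule eval_free_superset; auto)+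
  ultimately show ?thesis
    by (simp add: lookup_add scalar_mult_add sum.distrib)
qed

lemma eval_free_single: "eval_free (Poly_Mapping.single w r) = r \<cdot> wedges (map V (letters w))"
  by (subst eval_free_superset[of "{w}"]) auto

lemma eval_free_word: "eval_free (const_poly r * word_product vs) = r \<cdot> wedges (map V vs)"
  by (simp add: const_word_product eval_free_single)

lemma eval_free_word_product: "eval_free (word_product vs) = wedges (map V vs)"
  using eval_free_word[of 1 vs] by (simp add: const_poly_simps)

lemma eval_free_zero [simp]: "eval_free 0 = 0"
  by (simp add: eval_free_def)

lemma V_image [simp]: "V ` A \<subseteq> multivectors d" by auto

lemma eval_free_multivectors [simp]: "eval_free p \<in> multivectors d"
  unfolding eval_free_def by (intro multivectors_sum multivectors_scalar wedges_multivectors) auto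

lemma eval_free_mult:
  assumes p: "p \<in> carrier FA" and q: "q \<in> carrier FA"
  shows "eval_free (p * q) = eval_free p \<curlywedge> eval_free q"
proof -
  have "eval_free (const_poly r * word_product vs * q) = eval_free (const_poly r * word_product vs) \<curlywedge> eval_free q"
    for r vs
    using q
  proof (induction rule: FA_induct)
    case (add p q)
    then show ?case by (simp add: distrib_left eval_free_add wedge_add)
  next
    case (word s us)
    have "const_poly r * word_product vs * (const_poly s * word_product us)
        = Poly_Mapping.single (Word (vs @ us)) (r * s)"
      by (simp add: const_word_product mult_single plus_word_def)
    then show ?case
      by (simp add: eval_free_single eval_free_word wedges_append[where d = d] wedge_scalar mult.commute)
  qed
  with p show ?thesis
    by (induction rule: FA_induct) (simp_all add: distrib_right eval_free_add wedge_add)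
qed

lemma eval_free_const: "eval_free (const_poly r) = r \<cdot> basis_blade {}"
  by (simp add: const_poly_def eval_free_single zero_word_def)

lemma eval_free_scale: "p \<in> carrier FA \<Longrightarrow> eval_free (const_poly r * p) = r \<cdot> eval_free p"
  by (simp add: eval_free_mult eval_free_const wedge_scalar wedge_unit[where d = d])

lemma eval_free_diff: "eval_free (p - q) = eval_free p - eval_free q"
  using eval_free_add[of "p - q" q] by (simp add: algebra_simps)

lemma eval_free_letter: "eval_free (letter v) = V v"
  using eval_free_word_product[of "[v]"] by (simp add: wedge_unit[where d = d])

section \<open>The ideal of relations\<close>

lemma relations_carrier: "exterior_relations scale S \<subseteq> carrier FA"
  by (rule exterior_relations_carrier) (auto intro: add_S scale_S)

sublocale J: ideal J FA
  unfolding exterior_ideal_def by (rule FA.genideal_ideal[OF relations_carrier])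

lemma relations_J: "exterior_relations scale S \<subseteq> J"
  unfolding exterior_ideal_def by (rule FA.genideal_self[OF relations_carrier])

lemma J_zero [simp]: "0 \<in> J"
  using J.zero_closed by (simp add: FA_simps)

lemma J_add: "p \<in> J \<Longrightarrow> q \<in> J \<Longrightarrow> p + q \<in> J"
  using J.a_closed by (simp add: FA_simps)

lemma J_mult: "p \<in> J \<Longrightarrow> q \<in> carrier FA \<Longrightarrow> q * p \<in> J" "p \<in> J \<Longrightarrow> q \<in> carrier FA \<Longrightarrow> p * q \<in> J"
  using J.I_l_closed[of p q] J.I_r_closed[of p q] by (simp_all add: FA_simps)

lemma J_uminus: "p \<in> J \<Longrightarrow> - p \<in> J"
  using J_mult(1)[OF _ FA_const, of p "- 1"] by (simp add: const_poly_simps)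

text \<open>
  The kernel of the evaluation is an ideal containing the three families of relations. The additive
  and homogeneous ones are killed because coordinates are linear, the squares because vectors
  square to zero in the model.
\<close>

lemma eval_free_J:
  assumes "p \<in> J"
  shows "eval_free p = 0"
proof -
  let ?K = "{p \<in> carrier FA. eval_free p = 0}"
  have "ideal ?K FA"
  proof (rule idealI[OF ring_free_algebra])
    show "subgroup ?K (add_monoid FA)"
    proof (rule FA.add.subgroupI)
      fix p assume p: "p \<in> ?K"
      have "- p \<in> carrier FA" using p FA_diff[of 0 p] by simp
      moreover have "\<ominus>\<^bsub>FA\<^esub> p = - p"
        using p \<open>- p \<in> carrier FA\<close> by (intro FA.minus_equality) (simp_all add: FA_simps)
      ultimately show "\<ominus>\<^bsub>FA\<^esub> p \<in> ?K"
        using p eval_free_diff[of 0 p] by simp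
    qed (use FA_zero in \<open>auto simp: FA_simps eval_free_add\<close>)
  qed (auto simp: FA_simps eval_free_mult)
  moreover have "exterior_relations scale S \<subseteq> ?K"
  proof
    fix p assume p: "p \<in> exterior_relations scale S"
    then consider a b where "a \<in> S" "b \<in> S" "p = letter (a + b) - letter a - letter b"
      | r a where "a \<in> S" "p = letter (scale r a) - const_poly r * letter a"
      | a where "a \<in> S" "p = letter a * letter a"
      unfolding exterior_relations_def by blast
    then have "eval_free p = 0"
    proof cases
      case 1
      then have "c (a + b) = (\<lambda>i. c a i + c b i)" using c_add by blast
      then have "V (a + b) = V a + V b" by (simp add: vec_add)
      with 1 show ?thesis by (simp add: eval_free_diff eval_free_letter)
    next
      case 2
      then have "c (scale r a) = (\<lambda>i. r * c a i)" using c_scale by blast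
      then have "V (scale r a) = r \<cdot> V a" by (simp add: vec_scalar)
      with 2 show ?thesis by (simp add: eval_free_diff eval_free_letter eval_free_scale)
    next
      case 3
      then show ?thesis by (simp add: eval_free_mult eval_free_letter vec_alternating)
    qed
    with p relations_carrier show "p \<in> ?K" by auto
  qed
  ultimately have "J \<subseteq> ?K"
    unfolding exterior_ideal_def by (rule FA.genideal_minimal)
  with assms show ?thesis by auto
qed

definition congr :: "('v word \<Rightarrow>\<^sub>0 'k) \<Rightarrow> ('v word \<Rightarrow>\<^sub>0 'k) \<Rightarrow> bool" (infix "\<approx>" 50)
  where "p \<approx> q \<longleftrightarrow> p - q \<in> J"

lemma congr_refl [simp]: "p \<approx> p"
  by (simp add: congr_def)

lemma congr_sym: "p \<approx> q \<Longrightarrow> q \<approx> p"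
  using J_uminus[of "p - q"] by (simp add: congr_def)

lemma congr_trans [trans]: "p \<approx> q \<Longrightarrow> q \<approx> r \<Longrightarrow> p \<approx> r"
  using J_add[of "p - q" "q - r"] by (simp add: congr_def)

lemma congr_add: "p \<approx> q \<Longrightarrow> p' \<approx> q' \<Longrightarrow> p + p' \<approx> q + q'"
  using J_add[of "p - q" "p' - q'"] by (simp add: congr_def algebra_simps)

lemma congr_mult_left: "p \<approx> q \<Longrightarrow> r \<in> carrier FA \<Longrightarrow> r * p \<approx> r * q"
  using J_mult(1)[of "p - q" r] by (simp add: congr_def algebra_simps)

lemma congr_mult_right: "p \<approx> q \<Longrightarrow> r \<in> carrier FA \<Longrightarrow> p * r \<approx> q * r"
  using J_mult(2)[of "p - q" r] by (simp add: congr_def algebra_simps)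

lemma congr_sum: "(\<And>i. i \<in> A \<Longrightarrow> F i \<approx> G i) \<Longrightarrow> (\<Sum>i\<in>A. F i) \<approx> (\<Sum>i\<in>A. G i)"
  by (induction A rule: infinite_finite_induct) (auto intro: congr_add)

lemma letter_add: "a \<in> S \<Longrightarrow> b \<in> S \<Longrightarrow> letter (a + b) \<approx> letter a + letter b"
  using relations_J by (auto simp: congr_def exterior_relations_def diff_diff_eq)

lemma letter_scale: "a \<in> S \<Longrightarrow> letter (scale r a) \<approx> const_poly r * letter a"
  using relations_J by (auto simp: congr_def exterior_relations_def)

lemma letter_square: "a \<in> S \<Longrightarrow> letter a * letter a \<approx> 0"
  using relations_J by (auto simp: congr_def exterior_relations_def)

text \<open>
  Polarization of \<open>(a + b) \<and> (a + b) = 0\<close>.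
\<close>

lemma letter_anticommute:
  assumes a: "a \<in> S" and b: "b \<in> S"
  shows "letter a * letter b \<approx> - (letter b * letter a)"
proof -
  let ?l = "letter :: 'v \<Rightarrow> ('v word \<Rightarrow>\<^sub>0 'k)"
  have "(?l a + ?l b) * (?l a + ?l b) \<approx> ?l (a + b) * (?l a + ?l b)"
    using a b by (intro congr_mult_right congr_sym[OF letter_add]) auto
  also have "\<dots> \<approx> ?l (a + b) * ?l (a + b)"
    using a b by (intro congr_mult_left congr_sym[OF letter_add] FA_letter add_S)
  also have "\<dots> \<approx> 0"
    using a b by (intro letter_square add_S)
  finally have "?l a * ?l a + (?l a * ?l b + ?l b * ?l a) + ?l b * ?l b \<in> J"
    by (simp add: congr_def algebra_simps)
  moreover have "?l a * ?l a + ?l b * ?l b \<in> J"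
    using letter_square[OF a] letter_square[OF b] by (auto simp: congr_def intro: J_add)
  ultimately have "?l a * ?l a + (?l a * ?l b + ?l b * ?l a) + ?l b * ?l b + - (?l a * ?l a + ?l b * ?l b) \<in> J"
    by (rule J_add[OF _ J_uminus])
  then show ?thesis
    by (simp add: congr_def algebra_simps)
qed

lemma letter_expand:
  assumes "v \<in> S"
  shows "letter v \<approx> (\<Sum>i\<in>{1..d}. const_poly (c v i) * letter (x i))"
proof -
  let ?l = "letter :: 'v \<Rightarrow> ('v word \<Rightarrow>\<^sub>0 'k)"
  have "?l 0 \<approx> 0"
    using J_uminus[of "- ?l 0"] letter_add[OF zero_S zero_S] by (simp add: congr_def)
  have "(\<Sum>i\<in>A. scale (c v i) (x i)) \<in> S \<and>
      ?l (\<Sum>i\<in>A. scale (c v i) (x i)) \<approx> (\<Sum>i\<in>A. const_poly (c v i) * ?l (x i))"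
    if "finite A" "A \<subseteq> {1..d}" for A
    using that
  proof (induction A rule: finite_induct)
    case empty
    then show ?case using zero_S \<open>?l 0 \<approx> 0\<close> by simp
  next
    case (insert i A)
    then have i: "scale (c v i) (x i) \<in> S" and A: "(\<Sum>i\<in>A. scale (c v i) (x i)) \<in> S"
      and IH: "?l (\<Sum>i\<in>A. scale (c v i) (x i)) \<approx> (\<Sum>i\<in>A. const_poly (c v i) * ?l (x i))"
      using scale_S[OF x_S[of i]] by auto
    have "?l (scale (c v i) (x i) + (\<Sum>i\<in>A. scale (c v i) (x i))) \<approx>
        ?l (scale (c v i) (x i)) + ?l (\<Sum>i\<in>A. scale (c v i) (x i))"
      by (rule letter_add[OF i A])
    also have "\<dots> \<approx> const_poly (c v i) * ?l (x i) + (\<Sum>i\<in>A. const_poly (c v i) * ?l (x i))"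
      using insert by (intro congr_add letter_scale IH x_S) auto
    finally show ?case using insert i A by (auto intro: add_S)
  qed
  from this[of "{1..d}"] show ?thesis using expand[OF assms] by simp
qed

text \<open>
  One step of insertion sort: the new letter moves to the right past every smaller one, and dies on
  meeting itself.
\<close>

lemma word_product_insort:
  assumes "sorted js" "distinct js" "u ` set (i # js) \<subseteq> S"
  shows "letter (u i) * word_product (map u js) \<approx>
    (if i \<in> set js then 0
     else const_poly (shuffle_sign {i} (set js)) * word_product (map u (insort i js)))"
  using assms
proof (induction js)
  case Nil
  then show ?case by (simp add: const_poly_simps)
next
  case (Cons j js)
  let ?l = "letter :: 'v \<Rightarrow> ('v word \<Rightarrow>\<^sub>0 'k)"
  have S: "u i \<in> S" "u j \<in> S" "u ` set js \<subseteq> S" using Cons.prems by auto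
  have js: "word_product (map u js) \<in> carrier FA" using S by simp
  consider "i = j" | "i < j" | "j < i" by linarith
  then show ?case
  proof cases
    case 1
    have "(?l (u i) * ?l (u i)) * word_product (map u js) \<approx> 0 * word_product (map u js)"
      using S js by (intro congr_mult_right letter_square)
    with 1 show ?thesis by (simp add: mult.assoc)
  next
    case 2
    then have "i \<notin> set (j # js)" using Cons.prems(1) by auto
    moreover have "shuffle_sign {i} (set (j # js)) = (1 :: 'k)"
      using 2 Cons.prems(1) by (intro shuffle_sign_sorted) auto
    ultimately show ?thesis using 2 by (simp add: const_poly_simps)
  next
    case 3
    have "(?l (u i) * ?l (u j)) * word_product (map u js) \<approx> - (?l (u j) * ?l (u i)) * word_product (map u js)"
      using S js by (intro congr_mult_right letter_anticommute)
    also have "- (?l (u j) * ?l (u i)) * word_product (map u js) =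
        (- ?l (u j)) * (?l (u i) * word_product (map u js))"
      by (simp add: mult.assoc)
    also have "\<dots> \<approx> (- ?l (u j)) * (if i \<in> set js then 0
        else const_poly (shuffle_sign {i} (set js)) * word_product (map u (insort i js)))"
      using Cons S FA_diff[of 0 "?l (u j)"] by (intro congr_mult_left Cons.IH) auto
    also have "\<dots> = (if i \<in> set (j # js) then 0
        else const_poly (shuffle_sign {i} (set (j # js))) * word_product (map u (insort i (j # js))))"
    proof (cases "i \<in> set js")
      case False
      have "shuffle_sign {i} (set (j # js)) = (- shuffle_sign {i} (set js) :: 'k)"
      proof -
        have "{k \<in> set (j # js). k < i} = insert j {k \<in> set js. k < i}" using 3 by auto
        then show ?thesis using Cons.prems(2) by (simp add: shuffle_sign_singleton)
      qed
      with False 3 show ?thesis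
        using S by (simp add: const_poly_simps mult.assoc[symmetric] const_poly_commute)
    qed (use 3 in auto)
    finally show ?thesis by (simp add: mult.assoc)
  qed
qed

text \<open>
  Lets the arbitrary orderings of index sets be replaced by increasing ones, for any vectors.
\<close>

lemma word_product_sort:
  assumes "distinct is" "u ` set is \<subseteq> S"
  shows "word_product (map u is) \<approx>
    const_poly (inversion_sign is) * word_product (map u (sorted_list_of_set (set is)))"
  using assms
proof (induction "is")
  case (Cons i "is")
  let ?s = "sorted_list_of_set (set is)"
  have "letter (u i) * word_product (map u is) \<approx>
      letter (u i) * (const_poly (inversion_sign is) * word_product (map u ?s))"
    using Cons by (intro congr_mult_left Cons.IH) auto
  also have "\<dots> = const_poly (inversion_sign is) * (letter (u i) * word_product (map u ?s))"
    using Cons.prems by (simp add: mult.assoc[symmetric] const_poly_commute)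
  also have "\<dots> \<approx> const_poly (inversion_sign is) *
      (const_poly (shuffle_sign {i} (set is)) * word_product (map u (insort i ?s)))"
    using Cons.prems word_product_insort[of ?s u i] by (intro congr_mult_left) auto
  finally show ?case
    using Cons.prems by (simp add: const_poly_simps mult.assoc[symmetric] mult.commute)
qed (simp add: const_poly_simps)

lemma normal_form_add: "normal_form (f + g) = normal_form f + normal_form g"
  by (simp add: normal_form_def plus_fun_apply const_poly_simps distrib_right sum.distrib)

lemma normal_form_scalar: "normal_form (r \<cdot> f) = const_poly r * normal_form f"
  by (simp add: normal_form_def scalar_mult_apply const_poly_simps sum_distrib_left mult.assoc)

lemma normal_form_zero [simp]: "normal_form 0 = 0"
  using normal_form_scalar[of 0 0] by (simp add: const_poly_simps)

lemma normal_form_sum: "normal_form (\<Sum>i\<in>A. F i) = (\<Sum>i\<in>A. normal_form (F i))"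
  by (induction A rule: infinite_finite_induct) (auto simp: normal_form_add)

lemma x_image: "I \<subseteq> {1..d} \<Longrightarrow> x ` I \<subseteq> S"
  using x_S by auto

lemma normal_form_basis:
  assumes "I \<subseteq> {1..d}"
  shows "normal_form (basis_blade I) = word_product (map x (sorted_list_of_set I))"
proof -
  have "normal_form (basis_blade I) =
      (\<Sum>K\<in>Pow {1..d}. if K = I then word_product (map x (sorted_list_of_set K)) else 0)"
    unfolding normal_form_def by (rule sum.cong) (auto simp: basis_blade_def const_poly_simps)
  then show ?thesis using assms by simp
qed

lemma normal_form_carrier [simp]: "normal_form f \<in> carrier FA"
  unfolding normal_form_def
proof (intro FA_sum FA_mult FA_const FA_word_product)
  fix I assume I: "I \<in> Pow {1..d}"
  then have "finite I" by (auto intro: finite_subset)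
  with I show "set (map x (sorted_list_of_set I)) \<subseteq> S"
    using x_image by auto
qed

lemma eval_normal_form: "f \<in> multivectors d \<Longrightarrow> eval_free (normal_form f) = f"
proof (induction rule: multivectors_induct)
  case (add f g)
  then show ?case by (simp add: normal_form_add eval_free_add)
next
  case (scalar r f)
  then show ?case by (simp add: normal_form_scalar eval_free_scale)
next
  case (blade I)
  have fin: "finite I" using blade finite_subset by blast
  have "wedges (map V (map x (sorted_list_of_set I))) =
      wedges (map (\<lambda>i. basis_blade {i}) (sorted_list_of_set I))"
  proof (intro arg_cong[where f = wedges], simp, intro ballI)
    fix i assume "i \<in> set (sorted_list_of_set I)"
    then have "i \<in> {1..d}" using blade fin by auto
    then show "V (x i) = basis_blade {i}" by (intro vec_unit c_x)
  qed
  then show ?case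
    using fin by (simp add: normal_form_basis blade eval_free_word_product wedges_basis_list
        inversion_sign_sorted)
qed

lemma normal_form_letter:
  assumes v: "v \<in> S" and g: "g \<in> multivectors d"
  shows "letter v * normal_form g \<approx> normal_form (V v \<curlywedge> g)"
  using g
proof (induction rule: multivectors_induct)
  case (add f g)
  then show ?case by (simp add: normal_form_add wedge_add distrib_left congr_add)
next
  case (scalar r f)
  then have "const_poly r * (letter v * normal_form f) \<approx> const_poly r * normal_form (V v \<curlywedge> f)"
    by (intro congr_mult_left) auto
  then show ?case
    using v by (simp add: normal_form_scalar wedge_scalar mult.assoc[symmetric] const_poly_commute)
next
  case (blade I)
  have fin: "finite I" using blade finite_subset by blast
  let ?w = "word_product (map x (sorted_list_of_set I))"
  have w: "?w \<in> carrier FA" using x_image[OF blade] fin by simp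
  have "letter (x i) * ?w \<approx> normal_form (basis_blade {i} \<curlywedge> basis_blade I)" if i: "i \<in> {1..d}" for i
  proof -
    have "letter (x i) * ?w \<approx> (if i \<in> I then 0
        else const_poly (shuffle_sign {i} I) * word_product (map x (sorted_list_of_set (insert i I))))"
      using word_product_insort[of "sorted_list_of_set I" x i] fin x_image[OF blade] x_S[OF i]
      by (auto split: if_splits)
    also have "\<dots> = normal_form (basis_blade {i} \<curlywedge> basis_blade I)"
      using fin blade i by (simp add: basis_blade_singleton_wedge normal_form_scalar normal_form_basis)
    finally show ?thesis .
  qed
  note i = this
  have "letter v * ?w \<approx> (\<Sum>i\<in>{1..d}. const_poly (c v i) * letter (x i)) * ?w"
    using v w by (intro congr_mult_right letter_expand)
  also have "\<dots> = (\<Sum>i\<in>{1..d}. const_poly (c v i) * (letter (x i) * ?w))"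
    by (simp add: sum_distrib_right mult.assoc)
  also have "\<dots> \<approx> (\<Sum>i\<in>{1..d}. const_poly (c v i) * normal_form (basis_blade {i} \<curlywedge> basis_blade I))"
    by (intro congr_sum congr_mult_left i) auto
  also have "\<dots> = normal_form (V v \<curlywedge> basis_blade I)"
    by (simp add: vec_def wedge_sum wedge_scalar normal_form_sum normal_form_scalar)
  finally show ?case by (simp add: normal_form_basis blade)
qed

text \<open>
  Spanning. A word is brought to normal form from the right: each letter is expanded in the basis and
  its components are sorted into the normal form of the letters after it.
\<close>

lemma normal_form_congr:
  assumes "p \<in> carrier FA"
  shows "p \<approx> normal_form (eval_free p)"
  using assms
proof (induction rule: FA_induct)
  case (add p q)
  then show ?case by (simp add: eval_free_add normal_form_add congr_add)
next
  case (word r vs)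
  have "word_product vs \<approx> normal_form (wedges (map V vs))"
    using word
  proof (induction vs)
    case Nil
    then show ?case using normal_form_basis[of "{}"] by simp
  next
    case (Cons v vs)
    have "letter v * word_product vs \<approx> letter v * normal_form (wedges (map V vs))"
      using Cons by (intro congr_mult_left) auto
    also have "\<dots> \<approx> normal_form (V v \<curlywedge> wedges (map V vs))"
      using Cons by (intro normal_form_letter wedges_multivectors) auto
    finally show ?case by simp
  qed
  then show ?case
    by (simp add: eval_free_word normal_form_scalar congr_mult_left)
qed

text \<open>
  Evaluation kills no more than the ideal of relations, because elements with the same evaluation
  are congruent to the same normal form.
\<close>

lemma congr_iff: "p \<in> carrier FA \<Longrightarrow> q \<in> carrier FA \<Longrightarrow> p \<approx> q \<longleftrightarrow> eval_free p = eval_free q"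
  using eval_free_J[of "p - q"] normal_form_congr[of p] normal_form_congr[of q]
  by (auto simp: eval_free_diff congr_def[of p q] dest: congr_sym congr_trans)
    (metis congr_def congr_sym congr_trans)

section \<open>Coordinates of residue classes\<close>

definition cls :: "('v word \<Rightarrow>\<^sub>0 'k) \<Rightarrow> ('v word \<Rightarrow>\<^sub>0 'k) set"
  where "cls p = J +>\<^bsub>FA\<^esub> p"

text \<open>
  Evaluation is constant on residue classes, so the choice of representative does not matter.
\<close>

definition coord :: "('v word \<Rightarrow>\<^sub>0 'k) set \<Rightarrow> nat set \<Rightarrow> 'k"
  where "coord X = eval_free (SOME p. p \<in> X)"

lemma cls_eq: "cls p = {h + p | h. h \<in> J}"
  by (auto simp: cls_def a_r_coset_def' FA_simps)

lemma coord_cls: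
  assumes "p \<in> carrier FA"
  shows "coord (cls p) = eval_free p"
proof -
  have "p \<in> cls p" using J_zero by (force simp: cls_eq)
  then have "(SOME q. q \<in> cls p) \<in> cls p" by (rule someI)
  then obtain h where "h \<in> J" "(SOME q. q \<in> cls p) = h + p"
    by (auto simp: cls_eq)
  then show ?thesis
    by (simp add: coord_def eval_free_add eval_free_J)
qed

lemma carrier_E: "carrier E = cls ` carrier FA"
  by (auto simp: exterior_algebra_def FactRing_def A_RCOSETS_defs cls_def a_r_coset_def RCOSETS_def)

lemma cls_hom: "cls \<in> ring_hom FA E"
  using J.rcos_ring_hom unfolding exterior_algebra_def cls_def by simp

sublocale E: ring E
  unfolding exterior_algebra_def by (rule J.quotient_is_ring)

lemma cls_ops:
  assumes "p \<in> carrier FA" "q \<in> carrier FA"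
  shows "cls p \<oplus>\<^bsub>E\<^esub> cls q = cls (p + q)" "cls p \<otimes>\<^bsub>E\<^esub> cls q = cls (p * q)"
  using ring_hom_add[OF cls_hom assms] ring_hom_mult[OF cls_hom assms] by (simp_all add: FA_simps)

lemma cls_one: "\<one>\<^bsub>E\<^esub> = cls 1"
  using ring_hom_one[OF cls_hom] by (simp add: FA_simps)

lemma cls_zero: "\<zero>\<^bsub>E\<^esub> = cls 0"
  by (auto simp: exterior_algebra_def FactRing_def cls_eq)

lemma smult_cls: "p \<in> carrier FA \<Longrightarrow> exterior_smult scale S r (cls p) = cls (const_poly r * p)"
  by (simp add: exterior_smult_def cls_ops flip: cls_def)

lemma wedge_list_cls: "set vs \<subseteq> S \<Longrightarrow> wedge_list scale S vs = cls (word_product vs)"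
proof (induction vs)
  case Nil
  then show ?case by (simp add: wedge_list_def cls_one)
next
  case (Cons v vs)
  have "wedge_list scale S (v # vs) = cls (letter v) \<otimes>\<^bsub>E\<^esub> wedge_list scale S vs"
    by (simp add: wedge_list_def exterior_vector_def cls_def)
  with Cons show ?case by (simp add: cls_ops)
qed

lemma smult_closed [simp]: "\<xi> \<in> carrier E \<Longrightarrow> exterior_smult scale S r \<xi> \<in> carrier E"
  by (auto simp: carrier_E smult_cls)

lemma wedge_list_closed [simp]: "set vs \<subseteq> S \<Longrightarrow> wedge_list scale S vs \<in> carrier E"
  by (auto simp: carrier_E wedge_list_cls)

lemma coord_bij: "bij_betw coord (carrier E) (multivectors d)"
proof (rule bij_betw_imageI)
  have "cls p = cls q" if "p \<in> carrier FA" "q \<in> carrier FA" "eval_free p = eval_free q" for p q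
  proof -
    have sub: "cls p \<subseteq> cls q" if "p - q \<in> J" for p q
    proof
      fix y assume "y \<in> cls p"
      then obtain h where "h \<in> J" "y = h + p" by (auto simp: cls_eq)
      with that have "h + (p - q) \<in> J" "y = (h + (p - q)) + q" by (auto intro: J_add)
      then show "y \<in> cls q" unfolding cls_eq by blast
    qed
    have "p \<approx> q" "q \<approx> p" using that congr_iff by auto
    then show ?thesis unfolding congr_def by (intro equalityI sub)
  qed
  note cls_eqI = this
  show "inj_on coord (carrier E)"
  proof (rule inj_onI)
    fix X Y assume "X \<in> carrier E" "Y \<in> carrier E" and eq: "coord X = coord Y"
    then obtain p q where pq: "p \<in> carrier FA" "q \<in> carrier FA" "X = cls p" "Y = cls q"
      unfolding carrier_E by blast
    with eq have "eval_free p = eval_free q" by (simp only: coord_cls)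
    then have "cls p = cls q" by (rule cls_eqI[OF pq(1,2)])
    with pq show "X = Y" by simp
  qed
  have "f \<in> coord ` carrier E" if "f \<in> multivectors d" for f
    using eval_normal_form[OF that] coord_cls[of "normal_form f"]
    unfolding carrier_E by (intro image_eqI[of _ _ "cls (normal_form f)"]) auto
  then show "coord ` carrier E = multivectors d"
    unfolding carrier_E by (fastforce simp: coord_cls)
qed

lemma coord_eqI: "\<xi> \<in> carrier E \<Longrightarrow> \<eta> \<in> carrier E \<Longrightarrow> coord \<xi> = coord \<eta> \<Longrightarrow> \<xi> = \<eta>"
  using coord_bij by (auto simp: bij_betw_def inj_on_def)

lemma coord_multivectors [simp]: "\<xi> \<in> carrier E \<Longrightarrow> coord \<xi> \<in> multivectors d"
  using coord_bij by (auto simp: bij_betw_def)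

lemma coord_add: "\<xi> \<in> carrier E \<Longrightarrow> \<eta> \<in> carrier E \<Longrightarrow> coord (\<xi> \<oplus>\<^bsub>E\<^esub> \<eta>) = coord \<xi> + coord \<eta>"
  by (auto simp: carrier_E cls_ops coord_cls eval_free_add)

lemma coord_mult: "\<xi> \<in> carrier E \<Longrightarrow> \<eta> \<in> carrier E \<Longrightarrow> coord (\<xi> \<otimes>\<^bsub>E\<^esub> \<eta>) = coord \<xi> \<curlywedge> coord \<eta>"
  by (auto simp: carrier_E cls_ops coord_cls eval_free_mult)

lemma coord_smult: "\<xi> \<in> carrier E \<Longrightarrow> coord (exterior_smult scale S r \<xi>) = r \<cdot> coord \<xi>"
  by (auto simp: carrier_E smult_cls coord_cls eval_free_scale)

lemma coord_zero: "coord \<zero>\<^bsub>E\<^esub> = 0"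
  by (simp add: cls_zero coord_cls)

lemma coord_wedge_list: "set vs \<subseteq> S \<Longrightarrow> coord (wedge_list scale S vs) = wedges (map V vs)"
  by (simp add: wedge_list_cls coord_cls eval_free_word_product)

lemma coord_finsum:
  assumes "\<And>i. i \<in> A \<Longrightarrow> F i \<in> carrier E"
  shows "coord (\<Oplus>\<^bsub>E\<^esub>i\<in>A. F i) = (\<Sum>i\<in>A. coord (F i))"
  using assms
proof (induction A rule: infinite_finite_induct)
  case (insert i A)
  then show ?case
    by (subst E.finsum_insert) (auto intro!: E.finsum_closed simp: coord_add)
qed (auto simp: coord_zero E.finsum_infinite)

lemma coord_wedge_sort:
  assumes "distinct is" "u ` set is \<subseteq> S"
  shows "coord (wedge_list scale S (map u is)) = inversion_sign is \<cdot> wedge_of d (\<lambda>k. c (u k)) (set is)"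
proof -
  have S: "set (map u is) \<subseteq> S" "set (map u (sorted_list_of_set (set is))) \<subseteq> S" using assms by auto
  have "eval_free (word_product (map u is)) =
      eval_free (const_poly (inversion_sign is) * word_product (map u (sorted_list_of_set (set is))))"
    using S word_product_sort[OF assms] by (subst congr_iff[symmetric]) auto
  then show ?thesis
    using S by (simp add: coord_wedge_list eval_free_word eval_free_word_product wedge_of_def comp_def)
qed

lemma coord_wedge_basis:
  assumes "distinct is" "set is \<subseteq> {1..d}"
  shows "coord (wedge_list scale S (map x is)) = inversion_sign is \<cdot> basis_blade (set is)"
proof -
  have "map V (map x is) = map (\<lambda>i. basis_blade {i}) is"
    using assms(2) by (auto intro!: vec_unit c_x)
  then show ?thesis
    using assms(1) x_image[OF assms(2)] coord_wedge_list[of "map x is"] wedges_basis_list[OF assms(1), where 'a = 'k]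
    by (simp del: map_map)
qed

text \<open>
  The ordering of the basis products is a parameter since \<open>\<mu>\<close>-tilde is specified through the
  chosen orderings, and \<open>H\<close> is most easily evaluated on increasing ones.
\<close>

lemma E_induct [consumes 2, case_names add smult basis]:
  assumes ord: "index_ordering ord" and \<xi>: "\<xi> \<in> carrier E"
    and add: "\<And>\<xi> \<eta>. \<xi> \<in> carrier E \<Longrightarrow> \<eta> \<in> carrier E \<Longrightarrow> P \<xi> \<Longrightarrow> P \<eta> \<Longrightarrow> P (\<xi> \<oplus>\<^bsub>E\<^esub> \<eta>)"
    and smult: "\<And>r \<xi>. \<xi> \<in> carrier E \<Longrightarrow> P \<xi> \<Longrightarrow> P (exterior_smult scale S r \<xi>)"
    and basis: "\<And>I. I \<subseteq> {1..d} \<Longrightarrow> P (wedge_list scale S (map x (ord I)))"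
  shows "P \<xi>"
proof -
  have "\<exists>\<xi>\<in>carrier E. coord \<xi> = f \<and> P \<xi>" if "f \<in> multivectors d" for f
    using that
  proof (induction rule: multivectors_induct)
    case (add f g)
    then show ?case using assms(3) by (metis E.a_closed coord_add)
  next
    case (scalar r f)
    then show ?case using smult by (metis smult_closed coord_smult)
  next
    case (blade I)
    have "finite I" using blade by (auto intro: finite_subset)
    then have I: "distinct (ord I)" "set (ord I) = I"
      using ord by (auto simp: index_ordering_def)
    let ?b = "wedge_list scale S (map x (ord I))"
    have b: "?b \<in> carrier E" using x_image[OF blade] I by simp
    have "coord (exterior_smult scale S (inversion_sign (ord I)) ?b) = basis_blade I"
      using blade I b by (simp add: coord_smult coord_wedge_basis)
    with b show ?case using smult[OF b basis[OF blade]] smult_closed by blast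
  qed
  from this[of "coord \<xi>"] \<xi> show ?thesis
    using coord_eqI by auto
qed

end

section \<open>The regressive product in the exterior algebra\<close>

locale based_space =
  fixes scale :: "'k::field \<Rightarrow> 'v::ab_group_add \<Rightarrow> 'v" and x :: "nat \<Rightarrow> 'v" and d :: nat
  assumes vector_space: "vector_space scale"
    and basis: "ordered_basis scale x d"
begin

definition basis_coord :: "'v \<Rightarrow> nat \<Rightarrow> 'k"
  where "basis_coord v i = module.representation scale (x ` {1..d}) v (x i)"

sublocale vector_space scale by (rule vector_space)

lemma basis_facts:
  "inj_on x {1..d}" "independent (x ` {1..d})" "span (x ` {1..d}) = UNIV"
  using basis by (simp_all add: ordered_basis_def)

lemma basis_coord_x: "i \<in> {1..d} \<Longrightarrow> j \<in> {1..d} \<Longrightarrow> basis_coord (x i) j = (if j = i then 1 else 0)"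
  using basis_facts(1) by (simp add: basis_coord_def representation_basis[OF basis_facts(2)] inj_on_eq_iff)

lemma basis_coord_expand: "v = (\<Sum>i\<in>{1..d}. scale (basis_coord v i) (x i))"
proof -
  have "v = (\<Sum>b\<in>x ` {1..d}. scale (representation (x ` {1..d}) v b) b)"
    using sum_representation_eq[OF basis_facts(2), of v "x ` {1..d}"] basis_facts(3) by simp
  also have "\<dots> = (\<Sum>i\<in>{1..d}. scale (basis_coord v i) (x i))"
    by (subst sum.reindex[OF basis_facts(1)]) (simp add: basis_coord_def)
  finally show ?thesis .
qed

lemma basis_coord_linear: "Vector_Spaces.linear scale (*) (\<lambda>v. basis_coord v i)"
  unfolding basis_coord_def by (rule linear_representation[OF basis_facts(2,3)])

lemma vector_space_field: "vector_space ((*) :: 'k \<Rightarrow> 'k \<Rightarrow> 'k)"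
  by unfold_locales (simp_all add: algebra_simps)

lemma dual_space_iff:
  "f \<in> dual_space scale \<longleftrightarrow> (\<forall>a b. f (a + b) = f a + f b) \<and> (\<forall>r a. f (scale r a) = r * f a)"
  by (simp add: dual_space_def Vector_Spaces.linear_iff vector_space vector_space_field)

lemma dual_space_expand:
  assumes "f \<in> dual_space scale"
  shows "f v = (\<Sum>i\<in>{1..d}. basis_coord v i * f (x i))"
proof -
  have zero: "f 0 = 0"
    using assms[unfolded dual_space_iff] by (metis mult_zero_left scale_zero_right)
  have "f (\<Sum>i\<in>A. scale (basis_coord v i) (x i)) = (\<Sum>i\<in>A. basis_coord v i * f (x i))" for A
    using assms by (induction A rule: infinite_finite_induct) (simp_all add: zero dual_space_iff)
  then show ?thesis using basis_coord_expand[of v] by metis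
qed

lemma dual_basis_eq:
  assumes "i \<in> {1..d}"
  shows "dual_basis scale x d i = (\<lambda>v. basis_coord v i)"
  unfolding dual_basis_def
proof (rule the_equality)
  show "(\<lambda>v. basis_coord v i) \<in> dual_space scale \<and>
      (\<forall>j\<in>{1..d}. basis_coord (x j) i = (if i = j then 1 else 0))"
    using assms basis_coord_x by (simp add: dual_space_def basis_coord_linear)
next
  fix f assume f: "f \<in> dual_space scale \<and> (\<forall>j\<in>{1..d}. f (x j) = (if i = j then 1 else 0))"
  have "f v = basis_coord v i" for v
  proof -
    have "f v = (\<Sum>j\<in>{1..d}. if j = i then basis_coord v j else 0)"
      unfolding dual_space_expand[OF f[THEN conjunct1], of v] by (rule sum.cong) (use f in auto)
    then show ?thesis using assms by simp
  qed
  then show "f = (\<lambda>v. basis_coord v i)" by auto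
qed

sublocale P: exterior_coordinates scale UNIV x d basis_coord
proof unfold_locales
  fix v show "v = (\<Sum>i\<in>{1..d}. scale (basis_coord v i) (x i))" by (rule basis_coord_expand)
qed (use basis_coord_linear in \<open>simp_all add: basis_coord_x Vector_Spaces.linear_iff\<close>)

text \<open>
  The dual space, whose coordinates with respect to the dual basis are the values on the basis.
\<close>

sublocale N: exterior_coordinates dual_scale "dual_space scale" "dual_basis scale x d" d "\<lambda>f i. f (x i)"
proof unfold_locales
  fix f assume f: "f \<in> dual_space scale"
  have "f v = (\<Sum>i\<in>{1..d}. dual_scale (f (x i)) (dual_basis scale x d i)) v" for v
    unfolding sum_fun_apply dual_space_expand[OF f, of v] dual_scale_def
    by (rule sum.cong) (simp_all add: dual_basis_eq mult.commute)
  then show "f = (\<Sum>i\<in>{1..d}. dual_scale (f (x i)) (dual_basis scale x d i))" by (rule ext)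
next
  fix i assume "i \<in> {1..d}"
  then show "dual_basis scale x d i \<in> dual_space scale"
    by (simp add: dual_basis_eq dual_space_def basis_coord_linear)
next
  fix i j assume "i \<in> {1..d}" "j \<in> {1..d}"
  then show "dual_basis scale x d i (x j) = (if j = i then 1 else 0)"
    by (auto simp: dual_basis_eq basis_coord_x)
qed (auto simp: dual_space_iff dual_scale_def plus_fun_apply zero_fun_apply algebra_simps)

text \<open>
  A map satisfying the specification of \<open>H\<close>, obtained by transporting \<open>complement_map\<close> to the two
  exterior algebras; it shows that the specification can be met.
\<close>

definition H_coord :: "('v word \<Rightarrow>\<^sub>0 'k) set \<Rightarrow> (('v \<Rightarrow> 'k) word \<Rightarrow>\<^sub>0 'k) set"
  where "H_coord \<xi> = inv_into (carrier (Ext_dual scale)) N.coord (complement_map d (P.coord \<xi>))"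

lemma complement_map_bij: "bij_betw (complement_map d) (multivectors d) (multivectors d)"
  by (rule bij_betw_byWitness[where f' = "complement_inv d"]) (auto simp: complement_inverse)

lemma H_coord_bij: "bij_betw H_coord (carrier (Ext scale)) (carrier (Ext_dual scale))"
proof -
  have "bij_betw (inv_into (carrier (Ext_dual scale)) N.coord \<circ> complement_map d \<circ> P.coord)
      (carrier (Ext scale)) (carrier (Ext_dual scale))"
    by (intro bij_betw_trans[OF P.coord_bij] bij_betw_trans[OF complement_map_bij] bij_betw_inv_into N.coord_bij)
  then show ?thesis
    by (simp add: H_coord_def comp_def cong: bij_betw_cong)
qed

lemma H_coord_closed: "\<xi> \<in> carrier (Ext scale) \<Longrightarrow> H_coord \<xi> \<in> carrier (Ext_dual scale)"
  using H_coord_bij by (auto simp: bij_betw_def)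

lemma coord_H_coord:
  "\<xi> \<in> carrier (Ext scale) \<Longrightarrow> N.coord (H_coord \<xi>) = complement_map d (P.coord \<xi>)"
  using N.coord_bij unfolding H_coord_def bij_betw_def by (intro f_inv_into_f) simp

text \<open>
  The list of values of \<open>\<rho>\<close> splits after \<open>n\<close> entries, and its sign is the product of the signs of
  both parts with the shuffle sign of their sets. The first and third factor are what the complement map
  produces; on the dual side the second one occurs twice and cancels.
\<close>

lemma complement_map_wedge:
  assumes "n \<le> d" and \<rho>: "\<rho> permutes {1..d}"
  shows "complement_map d (P.coord (ext_wedge scale (map (\<lambda>k. x (\<rho> k)) [1..<Suc n]))) =
    N.coord (dual_smult scale (of_int (sign \<rho>))
      (dual_wedge scale (map (\<lambda>k. dual_basis scale x d (\<rho> k)) [Suc n..<Suc d])))"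
proof -
  let ?is = "map \<rho> [1..<Suc n]" and ?js = "map \<rho> [Suc n..<Suc d]"
  have app: "?is @ ?js = map \<rho> [1..<Suc d]"
    using \<open>n \<le> d\<close> upt_add_eq_append[of 1 "Suc n" "d - n"] by (simp flip: map_append)
  have "distinct (?is @ ?js)" "set (?is @ ?js) = {1..d}"
    unfolding app using inj_on_subset[OF permutes_inj[OF \<rho>]] permutes_image[OF \<rho>]
    by (simp_all add: distinct_map atLeastLessThanSuc_atLeastAtMost)
  then have dist: "distinct ?is" "distinct ?js" and sets: "set ?is \<subseteq> {1..d}" "set ?js \<subseteq> {1..d}"
    and js: "{1..d} - set ?is = set ?js" unfolding distinct_append set_append by blast+
  have sgn: "of_int (sign \<rho>) = (inversion_sign ?is * inversion_sign ?js * shuffle_sign (set ?is) (set ?js) :: 'k)"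
    using inversion_sign_permutation[OF \<rho>, where 'a = 'k] inversion_sign_append[OF \<open>distinct (?is @ ?js)\<close>, where 'a = 'k]
    unfolding app by simp
  have "P.coord (ext_wedge scale (map x ?is)) = inversion_sign ?is \<cdot> basis_blade (set ?is)"
    by (rule P.coord_wedge_basis[OF dist(1) sets(1)])
  moreover have "N.coord (dual_smult scale (of_int (sign \<rho>)) (dual_wedge scale (map (dual_basis scale x d) ?js)))
      = of_int (sign \<rho>) \<cdot> inversion_sign ?js \<cdot> basis_blade (set ?js)"
    using N.x_image[OF sets(2)] N.coord_wedge_basis[OF dist(2) sets(2)]
    by (subst N.coord_smult) (auto simp del: map_map)
  moreover have "inversion_sign ?is * shuffle_sign (set ?is) (set ?js) =
      (of_int (sign \<rho>) * inversion_sign ?js :: 'k)"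
    unfolding sgn using inversion_sign_square[of ?js, where 'a = 'k] by (simp add: mult_ac)
  ultimately show ?thesis
    using sets by (simp add: complement_map_linear complement_map_basis js comp_def del: set_map)
qed

lemma is_H_H_coord: "is_H scale x d H_coord"
  unfolding is_H_def
proof (intro conjI ballI allI impI)
  fix \<xi> \<eta> assume "\<xi> \<in> carrier (Ext scale)" "\<eta> \<in> carrier (Ext scale)"
  then show "H_coord (\<xi> \<oplus>\<^bsub>Ext scale\<^esub> \<eta>) = H_coord \<xi> \<oplus>\<^bsub>Ext_dual scale\<^esub> H_coord \<eta>"
    by (intro N.coord_eqI)
      (simp_all add: H_coord_closed coord_H_coord N.coord_add P.coord_add complement_map_linear)
next
  fix r \<xi> assume "\<xi> \<in> carrier (Ext scale)"
  then show "H_coord (ext_smult scale r \<xi>) = dual_smult scale r (H_coord \<xi>)"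
    by (intro N.coord_eqI)
      (simp_all add: H_coord_closed coord_H_coord N.coord_smult P.coord_smult complement_map_linear)
next
  fix n \<rho> assume n: "n \<le> d" and \<rho>: "\<rho> permutes {1..d}"
  have "\<rho> k \<in> {1..d}" if "k \<in> {Suc n..<Suc d}" for k
    using that permutes_in_image[OF \<rho>, of k] by auto
  then have "set (map (\<lambda>k. dual_basis scale x d (\<rho> k)) [Suc n..<Suc d]) \<subseteq> dual_space scale"
    using N.x_S by auto
  then show "H_coord (ext_wedge scale (map (\<lambda>k. x (\<rho> k)) [1..<Suc n])) =
      dual_smult scale (of_int (sign \<rho>))
        (dual_wedge scale (map (\<lambda>k. dual_basis scale x d (\<rho> k)) [Suc n..<Suc d]))"
    using complement_map_wedge[OF n \<rho>]
    by (intro N.coord_eqI) (simp_all add: H_coord_closed coord_H_coord)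
qed (rule H_coord_bij)

text \<open>
  Every admissible \<open>H\<close> has these coordinates: by linearity it is determined by its values on the
  basis, which the specification gives through a permutation that lists \<open>I\<close> first.
\<close>

lemma coord_H:
  assumes H: "is_H scale x d H" and \<xi>: "\<xi> \<in> carrier (Ext scale)"
  shows "N.coord (H \<xi>) = complement_map d (P.coord \<xi>)"
proof -
  have closed: "H \<xi> \<in> carrier (Ext_dual scale)" if "\<xi> \<in> carrier (Ext scale)" for \<xi>
    using H that by (auto simp: is_H_def bij_betw_def)
  have ord: "index_ordering sorted_list_of_set" by (simp add: index_ordering_def)
  show ?thesis
    using ord \<xi>
  proof (induction rule: P.E_induct)
    case (add \<xi> \<eta>)
    then have "H (\<xi> \<oplus>\<^bsub>Ext scale\<^esub> \<eta>) = H \<xi> \<oplus>\<^bsub>Ext_dual scale\<^esub> H \<eta>"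
      using H by (simp add: is_H_def)
    with add show ?case by (simp add: N.coord_add P.coord_add complement_map_linear closed)
  next
    case (smult r \<xi>)
    then have "H (ext_smult scale r \<xi>) = dual_smult scale r (H \<xi>)"
      using H by (simp add: is_H_def)
    with smult show ?case by (simp add: N.coord_smult P.coord_smult complement_map_linear closed)
  next
    case (basis I)
    let ?l = "sorted_list_of_set I @ sorted_list_of_set ({1..d} - I)"
    let ?\<rho> = "\<lambda>k. if k \<in> {1..length ?l} then ?l ! (k - 1) else k"
    have fin: "finite I" using basis finite_subset by blast
    have card: "card I \<le> d" using card_mono[OF _ basis] by simp
    have len: "length ?l = d" using basis fin card by (simp add: card_Diff_subset)
    have l: "distinct ?l" "set ?l = {1..length ?l}" using basis fin unfolding len by auto
    have "map (\<lambda>k. x (?\<rho> k)) [1..<Suc (card I)] = map x (sorted_list_of_set I)"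
      using card len fin by (intro nth_equalityI) (auto simp: nth_append)
    moreover have \<rho>: "?\<rho> permutes {1..d}"
      using list_permutes[OF l] len by simp
    moreover from \<rho> have "H (ext_wedge scale (map (\<lambda>k. x (?\<rho> k)) [1..<Suc (card I)])) =
        dual_smult scale (of_int (sign ?\<rho>))
          (dual_wedge scale (map (\<lambda>k. dual_basis scale x d (?\<rho> k)) [Suc (card I)..<Suc d]))"
      using H card unfolding is_H_def by blast
    ultimately show ?case
      using complement_map_wedge[OF card, of ?\<rho>] by simp
  qed
qed

lemma is_H_H_map: "is_H scale x d (H_map scale x d)"
  unfolding H_map_def by (rule someI[of "is_H scale x d", OF is_H_H_coord])

lemma regressive_closed_coord:
  assumes \<chi>: "\<chi> \<in> carrier (Ext scale)" and \<psi>: "\<psi> \<in> carrier (Ext scale)"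
  shows "regressive scale x d \<chi> \<psi> \<in> carrier (Ext scale) \<and>
    P.coord (regressive scale x d \<chi> \<psi>) = vee d (P.coord \<chi>) (P.coord \<psi>)"
proof -
  let ?H = "H_map scale x d"
  have bij: "bij_betw ?H (carrier (Ext scale)) (carrier (Ext_dual scale))"
    using is_H_H_map by (simp add: is_H_def)
  then have closed: "?H \<xi> \<in> carrier (Ext_dual scale)" if "\<xi> \<in> carrier (Ext scale)" for \<xi>
    using that by (auto simp: bij_betw_def)
  have "vee d (P.coord \<chi>) (P.coord \<psi>) \<in> P.coord ` carrier (Ext scale)"
    using P.coord_bij by (simp add: bij_betw_def)
  then obtain \<xi> where \<xi>: "\<xi> \<in> carrier (Ext scale)" "P.coord \<xi> = vee d (P.coord \<chi>) (P.coord \<psi>)"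
    by auto
  have "?H \<xi> = ?H \<chi> \<otimes>\<^bsub>Ext_dual scale\<^esub> ?H \<psi>"
  proof (rule N.coord_eqI)
    have "complement_map d (vee d (P.coord \<chi>) (P.coord \<psi>)) =
        complement_map d (P.coord \<chi>) \<curlywedge> complement_map d (P.coord \<psi>)"
      unfolding vee_def by (intro complement_inverse multivectors_wedge) auto
    then show "N.coord (?H \<xi>) = N.coord (?H \<chi> \<otimes>\<^bsub>Ext_dual scale\<^esub> ?H \<psi>)"
      using \<xi> \<chi> \<psi> by (simp add: N.coord_mult closed coord_H[OF is_H_H_map])
  qed (use \<xi> \<chi> \<psi> closed in auto)
  then have "regressive scale x d \<chi> \<psi> = \<xi>"
    using bij \<xi>(1) unfolding regressive_def bij_betw_def by (metis inv_into_f_f)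
  with \<xi> show ?thesis by simp
qed

lemmas regressive_closed [simp] = regressive_closed_coord[THEN conjunct1]
  and coord_regressive = regressive_closed_coord[THEN conjunct2]

lemma bracket_coord:
  assumes \<xi>: "\<xi> \<in> carrier (Ext scale)" and top: "homogeneous d d (P.coord \<xi>)"
  shows "bracket scale x d \<xi> = P.coord \<xi> {1..d}"
proof -
  let ?t = "ext_wedge scale (map x [1..<Suc d])"
  have t: "P.coord ?t = basis_blade {1..d}"
    by (subst P.coord_wedge_basis) (simp_all add: inversion_sign_sorted atLeastLessThanSuc_atLeastAtMost)
  have "P.coord \<xi> K = (P.coord \<xi> {1..d} \<cdot> basis_blade {1..d}) K" for K
  proof (cases "K = {1..d}")
    case False
    then have "P.coord \<xi> K = 0"
      using top card_subset_eq[of "{1..d}" K] by (auto simp: homogeneous_def)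
    with False show ?thesis by (simp add: scalar_mult_apply basis_blade_def)
  qed (simp add: scalar_mult_apply basis_blade_def)
  then have \<xi>t: "P.coord \<xi> = P.coord \<xi> {1..d} \<cdot> basis_blade {1..d}" by blast
  show ?thesis
    unfolding bracket_def
  proof (rule the_equality)
    show "\<xi> = ext_smult scale (P.coord \<xi> {1..d}) ?t"
      using \<xi> \<xi>t by (intro P.coord_eqI) (simp_all add: P.coord_smult t)
  next
    fix r assume "\<xi> = ext_smult scale r ?t"
    then have "P.coord \<xi> = r \<cdot> basis_blade {1..d}" by (simp add: P.coord_smult t)
    then show "r = P.coord \<xi> {1..d}" by (simp add: scalar_mult_apply basis_blade_def)
  qed
qed

lemma coord_wedge_upt:
  "P.coord (ext_wedge scale (map u [1..<Suc l])) = wedge_of d (\<lambda>k. basis_coord (u k)) {1..l}"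
  by (subst P.coord_wedge_sort) (simp_all add: inversion_sign_sorted atLeastLessThanSuc_atLeastAtMost)

context
  fixes ord :: "nat set \<Rightarrow> nat list"
  assumes ord: "index_ordering ord"
begin

lemma ord_simps:
  assumes "I \<subseteq> {1..l}"
  shows "distinct (ord I)" "set (ord I) = I" "distinct (ord ({1..l} - I))" "set (ord ({1..l} - I)) = {1..l} - I"
    "of_int (list_sign (ord ({1..l} - I) @ ord I)) =
      inversion_sign (ord ({1..l} - I)) * inversion_sign (ord I) * (shuffle_sign ({1..l} - I) I :: 'k)"
    "of_int (list_sign (ord I @ ord ({1..l} - I))) =
      inversion_sign (ord ({1..l} - I)) * inversion_sign (ord I) * (shuffle_sign I ({1..l} - I) :: 'k)"
proof -
  have fin: "finite I" using assms finite_subset by blast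
  then show *: "distinct (ord I)" "set (ord I) = I" "distinct (ord ({1..l} - I))" "set (ord ({1..l} - I)) = {1..l} - I"
    using ord by (auto simp: index_ordering_def)
  have "length (ord I) + length (ord ({1..l} - I)) = card I + card ({1..l} - I)"
    using * distinct_card by metis
  also have "\<dots> = l" using assms fin card_mono[of "{1..l}" I] by (simp add: card_Diff_subset)
  finally have len: "length (ord I) + length (ord ({1..l} - I)) = l" .
  have "distinct (ord I @ ord ({1..l} - I))" "distinct (ord ({1..l} - I) @ ord I)"
    "set (ord I @ ord ({1..l} - I)) = {1..length (ord I @ ord ({1..l} - I))}"
    "set (ord ({1..l} - I) @ ord I) = {1..length (ord ({1..l} - I) @ ord I)}"
    using * assms len by (auto simp: add.commute)
  then show "of_int (list_sign (ord ({1..l} - I) @ ord I)) =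
      inversion_sign (ord ({1..l} - I)) * inversion_sign (ord I) * (shuffle_sign ({1..l} - I) I :: 'k)"
    "of_int (list_sign (ord I @ ord ({1..l} - I))) =
      inversion_sign (ord ({1..l} - I)) * inversion_sign (ord I) * (shuffle_sign I ({1..l} - I) :: 'k)"
    using * by (simp_all add: list_sign_eq_inversion_sign inversion_sign_append mult_ac)
qed

lemma card_complement: "I \<subseteq> {1..l} \<Longrightarrow> card ({1..l} - I) = l - card I"
  by (subst card_Diff_subset) (auto intro: finite_subset)

text \<open>
  The chosen orderings enter each summand through the signs of \<open>ord I\<close> and of \<open>ord\<close> of the
  complement, once from the permutation sign and once from the products, so they cancel.
\<close>

lemma regressive_eq_mu_left:
  assumes \<beta>: "\<beta> \<in> carrier (Ext scale)" "homogeneous d m (P.coord \<beta>)" and "d \<le> l + m"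
  shows "regressive scale x d (ext_wedge scale (map u [1..<Suc l])) \<beta> =
    mu_left scale x d ord l (l + m - d) u \<beta>"
proof (rule P.coord_eqI)
  let ?w = "wedge_of d (\<lambda>k. basis_coord (u k))" and ?n = "l + m - d"
  let ?t = "\<lambda>I. ext_smult scale
         (of_int (list_sign (ord ({1..l} - I) @ ord I)) *
          bracket scale x d (ext_wedge scale (map u (ord ({1..l} - I))) \<otimes>\<^bsub>Ext scale\<^esub> \<beta>))
         (ext_wedge scale (map u (ord I)))"
  show "mu_left scale x d ord l ?n u \<beta> \<in> carrier (Ext scale)"
    unfolding mu_left_def by (intro P.E.finsum_closed) auto
  have "P.coord (?t I) = (shuffle_sign ({1..l} - I) I * (?w ({1..l} - I) \<curlywedge> P.coord \<beta>) {1..d}) \<cdot> ?w I"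
    if I: "I \<subseteq> {1..l}" "card I = ?n" for I
  proof -
    note o = ord_simps[OF I(1)]
    have w: "P.coord (ext_wedge scale (map u (ord ({1..l} - I)))) = inversion_sign (ord ({1..l} - I)) \<cdot> ?w ({1..l} - I)"
      "P.coord (ext_wedge scale (map u (ord I))) = inversion_sign (ord I) \<cdot> ?w I"
      using o P.coord_wedge_sort[of "ord ({1..l} - I)" u] P.coord_wedge_sort[of "ord I" u] by simp_all
    have "card I \<le> l" using I(1) card_mono[of "{1..l}" I] by simp
    then have deg: "card ({1..l} - I) + m = d"
      using I \<open>d \<le> l + m\<close> by (simp add: card_complement)
    have "homogeneous d d (?w ({1..l} - I) \<curlywedge> P.coord \<beta>)"
      using homogeneous_wedge[OF homogeneous_wedge_of \<beta>(2), of "{1..l} - I" "\<lambda>k. basis_coord (u k)"]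
      unfolding deg .
    then have "homogeneous d d (inversion_sign (ord ({1..l} - I)) \<cdot> (?w ({1..l} - I) \<curlywedge> P.coord \<beta>))"
      by (auto simp: homogeneous_def scalar_mult_apply)
    then have "bracket scale x d (ext_wedge scale (map u (ord ({1..l} - I))) \<otimes>\<^bsub>Ext scale\<^esub> \<beta>) =
        inversion_sign (ord ({1..l} - I)) * (?w ({1..l} - I) \<curlywedge> P.coord \<beta>) {1..d}"
      using \<beta>(1) by (subst bracket_coord) (simp_all add: P.coord_mult w wedge_scalar scalar_mult_apply)
    then show ?thesis
      by (simp add: P.coord_smult w o(5) inversion_sign_cancel)
  qed
  then have "P.coord (mu_left scale x d ord l ?n u \<beta>) =
      (\<Sum>I | I \<subseteq> {1..l} \<and> card I = ?n.
        (shuffle_sign ({1..l} - I) I * (?w ({1..l} - I) \<curlywedge> P.coord \<beta>) {1..d}) \<cdot> ?w I)"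
    unfolding mu_left_def by (subst P.coord_finsum) (auto intro!: sum.cong)
  then show "P.coord (regressive scale x d (ext_wedge scale (map u [1..<Suc l])) \<beta>) =
      P.coord (mu_left scale x d ord l ?n u \<beta>)"
    using \<beta>(1) vee_expansion_left[OF \<beta>(2) \<open>d \<le> l + m\<close>] by (simp add: coord_regressive coord_wedge_upt)
qed (use \<beta> in simp)

lemma regressive_eq_mu_right:
  assumes \<alpha>: "\<alpha> \<in> carrier (Ext scale)" "homogeneous d l (P.coord \<alpha>)" and "d \<le> l + m"
  shows "regressive scale x d \<alpha> (ext_wedge scale (map v [1..<Suc m])) =
    mu_right scale x d ord m (l + m - d) \<alpha> v"
proof (rule P.coord_eqI)
  let ?w = "wedge_of d (\<lambda>k. basis_coord (v k))" and ?n = "l + m - d"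
  let ?t = "\<lambda>I. ext_smult scale
         (of_int (list_sign (ord I @ ord ({1..m} - I))) *
          bracket scale x d (\<alpha> \<otimes>\<^bsub>Ext scale\<^esub> ext_wedge scale (map v (ord ({1..m} - I)))))
         (ext_wedge scale (map v (ord I)))"
  show "mu_right scale x d ord m ?n \<alpha> v \<in> carrier (Ext scale)"
    unfolding mu_right_def by (intro P.E.finsum_closed) auto
  have "P.coord (?t I) = (shuffle_sign I ({1..m} - I) * (P.coord \<alpha> \<curlywedge> ?w ({1..m} - I)) {1..d}) \<cdot> ?w I"
    if I: "I \<subseteq> {1..m}" "card I = ?n" for I
  proof -
    note o = ord_simps[OF I(1)]
    have w: "P.coord (ext_wedge scale (map v (ord ({1..m} - I)))) = inversion_sign (ord ({1..m} - I)) \<cdot> ?w ({1..m} - I)"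
      "P.coord (ext_wedge scale (map v (ord I))) = inversion_sign (ord I) \<cdot> ?w I"
      using o P.coord_wedge_sort[of "ord ({1..m} - I)" v] P.coord_wedge_sort[of "ord I" v] by simp_all
    have "card I \<le> m" using I(1) card_mono[of "{1..m}" I] by simp
    then have deg: "l + card ({1..m} - I) = d"
      using I \<open>d \<le> l + m\<close> by (simp add: card_complement)
    have "homogeneous d d (P.coord \<alpha> \<curlywedge> ?w ({1..m} - I))"
      using homogeneous_wedge[OF \<alpha>(2) homogeneous_wedge_of, of "{1..m} - I" "\<lambda>k. basis_coord (v k)"]
      unfolding deg .
    then have "homogeneous d d (inversion_sign (ord ({1..m} - I)) \<cdot> (P.coord \<alpha> \<curlywedge> ?w ({1..m} - I)))"
      by (auto simp: homogeneous_def scalar_mult_apply)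
    then have "bracket scale x d (\<alpha> \<otimes>\<^bsub>Ext scale\<^esub> ext_wedge scale (map v (ord ({1..m} - I)))) =
        inversion_sign (ord ({1..m} - I)) * (P.coord \<alpha> \<curlywedge> ?w ({1..m} - I)) {1..d}"
      using \<alpha>(1) by (subst bracket_coord) (simp_all add: P.coord_mult w wedge_scalar scalar_mult_apply)
    then show ?thesis
      by (simp add: P.coord_smult w o(6) inversion_sign_cancel)
  qed
  then have "P.coord (mu_right scale x d ord m ?n \<alpha> v) =
      (\<Sum>I | I \<subseteq> {1..m} \<and> card I = ?n.
        (shuffle_sign I ({1..m} - I) * (P.coord \<alpha> \<curlywedge> ?w ({1..m} - I)) {1..d}) \<cdot> ?w I)"
    unfolding mu_right_def by (subst P.coord_finsum) (auto intro!: sum.cong)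
  then show "P.coord (regressive scale x d \<alpha> (ext_wedge scale (map v [1..<Suc m]))) =
      P.coord (mu_right scale x d ord m ?n \<alpha> v)"
    using \<alpha>(1) vee_expansion_right[OF \<alpha>(2) \<open>d \<le> l + m\<close>] by (simp add: coord_regressive coord_wedge_upt)
qed (use \<alpha> in simp)

lemma regressive_blades:
  assumes "\<alpha> = ext_wedge scale (map u [1..<Suc l])" "\<beta> = ext_wedge scale (map v [1..<Suc m])" "d \<le> l + m"
  shows "regressive scale x d \<alpha> \<beta> = mu_left scale x d ord l (l + m - d) u \<beta>"
    "regressive scale x d \<alpha> \<beta> = mu_right scale x d ord m (l + m - d) \<alpha> v"
proof -
  have "homogeneous d l (P.coord \<alpha>)" "homogeneous d m (P.coord \<beta>)"
    using homogeneous_wedge_of[of d "{1..l}"] homogeneous_wedge_of[of d "{1..m}"]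
    by (simp_all add: assms coord_wedge_upt)
  then show "regressive scale x d \<alpha> \<beta> = mu_left scale x d ord l (l + m - d) u \<beta>"
    "regressive scale x d \<alpha> \<beta> = mu_right scale x d ord m (l + m - d) \<alpha> v"
    using assms(3) regressive_eq_mu_left[of \<beta> m l u] regressive_eq_mu_right[of \<alpha> l m v]
    by (simp_all add: assms(1,2))
qed

text \<open>
  Any factorizations of \<open>\<alpha>\<close> and \<open>\<beta>\<close> give the value \<open>\<alpha> \<or> \<beta>\<close>, and at least one exists, so the
  definite description in \<open>\<mu>\<close> denotes it.
\<close>

lemma mu_eq_regressive:
  assumes "\<alpha> = ext_wedge scale (map u [1..<Suc l])" "\<beta> = ext_wedge scale (map v [1..<Suc m])" "d \<le> l + m"
  shows "mu scale x d ord \<alpha> \<beta> = regressive scale x d \<alpha> \<beta>"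
  unfolding mu_def
proof (rule the_equality)
  show "\<forall>l m u v. \<alpha> = ext_wedge scale (map u [1..<Suc l]) \<and>
      \<beta> = ext_wedge scale (map v [1..<Suc m]) \<and> d \<le> l + m \<longrightarrow>
      regressive scale x d \<alpha> \<beta> = mu_left scale x d ord l (l + m - d) u \<beta> \<and>
      regressive scale x d \<alpha> \<beta> = mu_right scale x d ord m (l + m - d) \<alpha> v"
    by (intro allI impI conjI; elim conjE) (rule regressive_blades; assumption)+
next
  fix \<gamma> assume "\<forall>l m u v. \<alpha> = ext_wedge scale (map u [1..<Suc l]) \<and>
      \<beta> = ext_wedge scale (map v [1..<Suc m]) \<and> d \<le> l + m \<longrightarrow>
      \<gamma> = mu_left scale x d ord l (l + m - d) u \<beta> \<and>
      \<gamma> = mu_right scale x d ord m (l + m - d) \<alpha> v"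
  from this[rule_format, of u l v m] assms have "\<gamma> = mu_left scale x d ord l (l + m - d) u \<beta>" by simp
  then show "\<gamma> = regressive scale x d \<alpha> \<beta>" using regressive_blades(1)[OF assms] by simp
qed

lemma mu_basis:
  assumes I: "I \<subseteq> {1..d}" and K: "K \<subseteq> {1..d}"
  shows "regressive scale x d (ext_wedge scale (map x (ord I))) (ext_wedge scale (map x (ord K))) =
    (if card I + card K \<ge> d
     then mu scale x d ord (ext_wedge scale (map x (ord I))) (ext_wedge scale (map x (ord K)))
     else \<zero>\<^bsub>Ext scale\<^esub>)"
proof -
  note o = ord_simps(1,2)[OF I] ord_simps(1,2)[OF K]
  have fin: "finite I" "finite K" using I K finite_subset by blast+
  have shift: "ext_wedge scale (map x xs) = ext_wedge scale (map (\<lambda>k. x (xs ! (k - 1))) [1..<Suc (length xs)])"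
    for xs :: "nat list"
    by (rule arg_cong[of _ _ "ext_wedge scale"], rule nth_equalityI) auto
  show ?thesis
  proof (cases "card I + card K \<ge> d")
    case True
    then have "d \<le> length (ord I) + length (ord K)" using o by (metis distinct_card)
    from mu_eq_regressive[OF _ _ this, OF shift shift] True
    show ?thesis by simp
  next
    case False
    then have "card (I \<union> K) < d" using card_Un_le[of I K] by linarith
    then have "I \<union> K \<noteq> {1..d}" by auto
    then have "P.coord (regressive scale x d (ext_wedge scale (map x (ord I))) (ext_wedge scale (map x (ord K)))) = 0"
      using o I K by (simp add: coord_regressive P.coord_wedge_basis vee_scalar vee_basis)
    then have "regressive scale x d (ext_wedge scale (map x (ord I))) (ext_wedge scale (map x (ord K))) =
        \<zero>\<^bsub>Ext scale\<^esub>"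
      by (intro P.coord_eqI) (simp_all add: P.coord_zero)
    with False show ?thesis by simp
  qed
qed

lemma is_mu_tilde_regressive: "is_mu_tilde scale x d ord (regressive scale x d)"
proof -
  have "ext_bilinear scale (regressive scale x d)"
    unfolding ext_bilinear_def
    by (intro ballI conjI allI; (rule regressive_closed | rule P.coord_eqI))
      (simp_all add: coord_regressive P.coord_add P.coord_smult vee_add vee_scalar)
  then show ?thesis
    unfolding is_mu_tilde_def using mu_basis by blast
qed

text \<open>
  This makes the indefinite choice in \<open>\<mu>\<close>-tilde harmless: a bilinear map is determined by its values
  on pairs of basis products.
\<close>

lemma is_mu_tilde_unique:
  assumes f: "is_mu_tilde scale x d ord f" and g: "is_mu_tilde scale x d ord g"
    and \<eta>: "\<eta> \<in> carrier (Ext scale)" and \<zeta>: "\<zeta> \<in> carrier (Ext scale)"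
  shows "f \<eta> \<zeta> = g \<eta> \<zeta>"
proof -
  have bil: "ext_bilinear scale f" "ext_bilinear scale g" using f g by (auto simp: is_mu_tilde_def)
  have "f (ext_wedge scale (map x (ord I))) \<zeta> = g (ext_wedge scale (map x (ord I))) \<zeta>"
    if I: "I \<subseteq> {1..d}" for I
    using ord \<zeta>
  proof (induction rule: P.E_induct)
    case (basis K)
    then show ?case using f g I unfolding is_mu_tilde_def by metis
  qed (use bil in \<open>simp_all add: ext_bilinear_def\<close>)
  note blades = this
  show ?thesis
    using ord \<eta>
  proof (induction rule: P.E_induct)
    case (basis I)
    then show ?case by (rule blades)
  qed (use bil \<zeta> in \<open>simp_all add: ext_bilinear_def\<close>)
qed

lemma mu_tilde_eq_regressive:
  "\<eta> \<in> carrier (Ext scale) \<Longrightarrow> \<zeta> \<in> carrier (Ext scale) \<Longrightarrow>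
    mu_tilde scale x d ord \<eta> \<zeta> = regressive scale x d \<eta> \<zeta>"
  unfolding mu_tilde_def
  by (rule is_mu_tilde_unique[OF someI[of "is_mu_tilde scale x d ord"]])
    (rule is_mu_tilde_regressive)+

end

end

theorem mainTheorem4:
  fixes scale :: "'k::field \<Rightarrow> 'v::ab_group_add \<Rightarrow> 'v"
    and x :: "nat \<Rightarrow> 'v" and d :: nat and ord :: "nat set \<Rightarrow> nat list"
  assumes "vector_space scale"
    and "ordered_basis scale x d"
    and "index_ordering ord"
  shows "(\<forall>\<eta>\<in>carrier (Ext scale). \<forall>\<zeta>\<in>carrier (Ext scale).
            mu_tilde scale x d ord \<eta> \<zeta> = regressive scale x d \<eta> \<zeta>) \<and>
         (\<forall>l m n u v \<alpha> \<beta>.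
            \<alpha> = ext_wedge scale (map u [1..<Suc l]) \<and> \<alpha> \<noteq> \<zero>\<^bsub>Ext scale\<^esub> \<and>
            \<beta> = ext_wedge scale (map v [1..<Suc m]) \<and> \<beta> \<noteq> \<zero>\<^bsub>Ext scale\<^esub> \<and>
            d \<le> l + m \<and> n = l + m - d \<longrightarrow>
              regressive scale x d \<alpha> \<beta> =
                (\<Oplus>\<^bsub>Ext scale\<^esub> I \<in> {I. I \<subseteq> {1..l} \<and> card I = n}.
                   ext_smult scale
                     (of_int (list_sign (ord ({1..l} - I) @ ord I)) *
                      bracket scale x d
                        (ext_wedge scale (map u (ord ({1..l} - I))) \<otimes>\<^bsub>Ext scale\<^esub> \<beta>))
                     (ext_wedge scale (map u (ord I)))) \<and>
              regressive scale x d \<alpha> \<beta> =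
                (\<Oplus>\<^bsub>Ext scale\<^esub> I \<in> {I. I \<subseteq> {1..m} \<and> card I = n}.
                   ext_smult scale
                     (of_int (list_sign (ord I @ ord ({1..m} - I))) *
                      bracket scale x d
                        (\<alpha> \<otimes>\<^bsub>Ext scale\<^esub> ext_wedge scale (map v (ord ({1..m} - I)))))
                     (ext_wedge scale (map v (ord I)))))"
proof -
  interpret based_space scale x d by (rule based_space.intro) (rule assms)+
  show ?thesis
  proof ((intro conjI ballI allI impI; (elim conjE)?), goal_cases)
    case (1 \<eta> \<zeta>)
    then show ?case by (rule mu_tilde_eq_regressive[OF assms(3)])
  next
    case (2 l m n u v \<alpha> \<beta>)
    show ?case
      unfolding 2(6) by (rule regressive_blades(1)[OF assms(3) 2(1,3,5), unfolded mu_left_def])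
  next
    case (3 l m n u v \<alpha> \<beta>)
    show ?case
      unfolding 3(6) by (rule regressive_blades(2)[OF assms(3) 3(1,3,5), unfolded mu_right_def])
  qed
qed

end
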